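(* Let $(R,\mathfrak{m})$ be a Cohen-Macaulay local ring and let $I$ be a non-nilpotent ideal of $R$ such that $\operatorname{mAss}_R(R/I)\subseteq \operatorname{Ass}_R(R)$. Then $R/\bigl(I+\bigcup_{n\ge 1}(0:_R I^n)\bigr)$ is an equidimensional local ring of dimension $\dim R-1$.
   Context: Rings are commutative with identity and Noetherian. For an ideal $I$ of $R$ and $n\ge 1$, $(0:_R I^n)=\{r\in R : rI^n=0\}$. $\operatorname{Ass}_R(L)$ is the set of associated primes of an $R$-module $L$, and $\operatorname{mAss}_R(L)$ is the set of minimal elements (under inclusion) of $\operatorname{Ass}_R(L)$. A Noetherian ring $A$ of finite Krull dimension $d$ is called equidimensional if $\dim A/\mathfrak{p}=d$ for every minimal prime ideal $\mathfrak{p}$ of $A$.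
   Formalization: The ideal I is assumed to be proper (I ≠ R); for I = R the stated hypotheses hold (R is non-nilpotent and mAss of the zero module is empty), but the quotient is the zero ring, which is not local. *)

theory Defs
  imports "HOL-Algebra.Algebra" "HOL-Library.Extended_Nat"
begin

section \<open>Noetherian local rings and Krull dimension\<close>

locale noetherian_local_ring = cring R + noetherian_ring R for R (structure) +
  fixes \<mm> :: "'a set"
  assumes maximal: "maximalideal \<mm> R"
    and unique_maximal: "maximalideal J R \<Longrightarrow> J = \<mm>"

text \<open>
  The length of a chain of \<open>n + 1\<close> primes is \<open>n\<close>. The zero ring has no primes and gets the
  junk value \<open>0\<close>; no local ring and no quotient by a prime ideal is the zero ring.
\<close>
definition krull_dim :: "('a, 'b) ring_scheme \<Rightarrow> enat" where
  "krull_dim R = Sup {enat n | n. \<exists>p. (\<forall>i\<le>n. primeideal (p i) R) \<and> (\<forall>i<n. p i \<subset> p (Suc i))}"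

definition minimal_prime :: "('a, 'b) ring_scheme \<Rightarrow> 'a set \<Rightarrow> bool" where
  "minimal_prime R P \<longleftrightarrow> primeideal P R \<and> (\<forall>Q. primeideal Q R \<and> Q \<subseteq> P \<longrightarrow> Q = P)"

definition equidimensional :: "('a, 'b) ring_scheme \<Rightarrow> bool" where
  "equidimensional A \<longleftrightarrow> cring A \<and> noetherian_ring A \<and>
     (\<exists>d. krull_dim A = enat d \<and> (\<forall>P. minimal_prime A P \<longrightarrow> krull_dim (A Quot P) = enat d))"

section \<open>Depth and the Cohen-Macaulay property\<close>

definition nonzerodivisor :: "('a, 'b) ring_scheme \<Rightarrow> 'a \<Rightarrow> bool" where
  "nonzerodivisor R x \<longleftrightarrow> x \<in> carrier R \<and> (\<forall>a\<in>carrier R. x \<otimes>\<^bsub>R\<^esub> a = \<zero>\<^bsub>R\<^esub> \<longrightarrow> a = \<zero>\<^bsub>R\<^esub>)"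

definition regular_sequence :: "('a, 'b) ring_scheme \<Rightarrow> 'a list \<Rightarrow> bool" where
  "regular_sequence R xs \<longleftrightarrow> set xs \<subseteq> carrier R \<and>
     (\<forall>i<length xs. let J = Idl\<^bsub>R\<^esub> (set (take i xs)) in nonzerodivisor (R Quot J) (J +>\<^bsub>R\<^esub> xs ! i)) \<and>
     Idl\<^bsub>R\<^esub> (set xs) \<noteq> carrier R"

definition depth :: "('a, 'b) ring_scheme \<Rightarrow> 'a set \<Rightarrow> enat" where
  "depth R \<mm> = Sup {enat (length xs) | xs. regular_sequence R xs \<and> set xs \<subseteq> \<mm>}"

locale cohen_macaulay_local_ring = noetherian_local_ring +
  assumes depth_eq_dim: "depth R \<mm> = krull_dim R"

section \<open>Associated primes\<close>

definition ass :: "('a, 'b) ring_scheme \<Rightarrow> ('a, 'c, 'd) module_scheme \<Rightarrow> 'a set set" where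
  "ass R M = {P. primeideal P R \<and>
     (\<exists>x\<in>carrier M. P = {r \<in> carrier R. r \<odot>\<^bsub>M\<^esub> x = \<zero>\<^bsub>M\<^esub>})}"

definition mass :: "('a, 'b) ring_scheme \<Rightarrow> ('a, 'c, 'd) module_scheme \<Rightarrow> 'a set set" where
  "mass R M = {P \<in> ass R M. \<forall>Q\<in>ass R M. Q \<subseteq> P \<longrightarrow> Q = P}"

definition self_module :: "('a, 'b) ring_scheme \<Rightarrow> ('a, 'a) module" where
  "self_module R = \<lparr>carrier = carrier R, monoid.mult = (\<otimes>\<^bsub>R\<^esub>), monoid.one = \<one>\<^bsub>R\<^esub>, ring.zero = \<zero>\<^bsub>R\<^esub>,
     ring.add = (\<oplus>\<^bsub>R\<^esub>), smult = (\<otimes>\<^bsub>R\<^esub>)\<rparr>"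

text \<open>\<open>R/I\<close> as an \<open>R\<close>-module, by restriction of scalars along \<open>R \<rightarrow> R/I\<close>.\<close>
definition quot_module :: "('a, 'b) ring_scheme \<Rightarrow> 'a set \<Rightarrow> ('a, 'a set) module" where
  "quot_module R I = \<lparr>carrier = carrier (R Quot I), monoid.mult = (\<otimes>\<^bsub>R Quot I\<^esub>), monoid.one = \<one>\<^bsub>R Quot I\<^esub>,
     ring.zero = \<zero>\<^bsub>R Quot I\<^esub>, ring.add = (\<oplus>\<^bsub>R Quot I\<^esub>),
     smult = (\<lambda>r c. (I +>\<^bsub>R\<^esub> r) \<otimes>\<^bsub>R Quot I\<^esub> c)\<rparr>"

lemma abelian_group_cong:
  assumes "abelian_group R" "carrier M = carrier R" "\<zero>\<^bsub>M\<^esub> = \<zero>\<^bsub>R\<^esub>" "(\<oplus>\<^bsub>M\<^esub>) = (\<oplus>\<^bsub>R\<^esub>)"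
  shows "abelian_group M"
proof -
  interpret R: abelian_group R by fact
  show ?thesis
  proof (rule abelian_groupI)
    fix x assume "x \<in> carrier M"
    then have "\<ominus>\<^bsub>R\<^esub> x \<in> carrier M" "\<ominus>\<^bsub>R\<^esub> x \<oplus>\<^bsub>M\<^esub> x = \<zero>\<^bsub>M\<^esub>"
      by (simp_all add: assms(2-) R.l_neg)
    then show "\<exists>y\<in>carrier M. y \<oplus>\<^bsub>M\<^esub> x = \<zero>\<^bsub>M\<^esub>" by blast
  qed (simp_all add: assms(2-) R.a_ac)
qed

lemma (in cring) module_self_module: "module R (self_module R)"
proof (rule moduleI)
  show "abelian_group (self_module R)"
    by (rule abelian_group_cong[OF abelian_group_axioms]) (simp_all add: self_module_def)
qed (auto simp: self_module_def is_cring l_distr r_distr m_assoc)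

lemma (in cring) module_quot_module:
  assumes "ideal I R"
  shows "module R (quot_module R I)"
proof -
  interpret I: ideal I R by fact
  interpret Q: cring "R Quot I" by (rule I.quotient_is_cring[OF is_cring])
  interpret h: ring_hom_ring R "R Quot I" "(+>) I" by (rule I.rcos_ring_hom_ring)
  show ?thesis
  proof (rule moduleI)
    show "abelian_group (quot_module R I)"
      by (rule abelian_group_cong[OF Q.abelian_group_axioms]) (simp_all add: quot_module_def)
  next
    fix x assume "x \<in> carrier (quot_module R I)"
    then show "\<one> \<odot>\<^bsub>quot_module R I\<^esub> x = x"
      using h.hom_one by (simp add: quot_module_def)
  qed (auto simp: quot_module_def is_cring Q.l_distr Q.r_distr Q.m_assoc)
qed

section \<open>Ideals\<close>

definition zero_colon :: "('a, 'b) ring_scheme \<Rightarrow> 'a set \<Rightarrow> 'a set" where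
  "zero_colon R J = {r \<in> carrier R. \<forall>x\<in>J. r \<otimes>\<^bsub>R\<^esub> x = \<zero>\<^bsub>R\<^esub>}"

text \<open>Powers of ideals are taken in the library's multiplicative monoid of ideals.\<close>
abbreviation ideal_pow :: "('a, 'b) ring_scheme \<Rightarrow> 'a set \<Rightarrow> nat \<Rightarrow> 'a set" where
  "ideal_pow R I n \<equiv> I [^]\<^bsub>ideals_set R\<^esub> n"

definition nilpotent_ideal :: "('a, 'b) ring_scheme \<Rightarrow> 'a set \<Rightarrow> bool" where
  "nilpotent_ideal R I \<longleftrightarrow> (\<exists>n\<ge>1. ideal_pow R I n = {\<zero>\<^bsub>R\<^esub>})"

end

theory Submission
  imports Defs
begin

text \<open>
  Let \<open>d = dim R\<close> and \<open>J = \<Union>\<^sub>n (0 : I\<^sup>n)\<close>. Since \<open>R\<close> is Noetherian, \<open>J = (0 : I\<^sup>N)\<close> for some \<open>N\<close>,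
  and \<open>(J : I) = J\<close>. The variety of \<open>J\<close> is the union of the components of \<open>Spec R\<close> that do not
  lie in \<open>V(I)\<close>; the hypothesis on \<open>I\<close> says that \<open>V(I)\<close> is the union of the other components.
  So \<open>V(I)\<close> and \<open>V(J)\<close> cover \<open>Spec R\<close>, and at a minimal prime \<open>Q\<close> of \<open>I + J\<close> they meet only in
  the closed point of \<open>Spec R\<^sub>Q\<close>: the punctured spectrum is disconnected. By Hartshorne's
  connectedness theorem \<open>depth R\<^sub>Q \<le> 1\<close>, and in a Cohen-Macaulay ring this forces
  \<open>dim R/Q = d - 1\<close>.

  The proof below follows this idea without localising and without homological algebra. Write
  \<open>Ass(R/c)\<close> for the primes of the form \<open>(c : w)\<close>. Four results carry it.

  \<^item> \<open>regseq_prime_chain\<close>: if \<open>P \<in> Ass(R/c)\<close> and \<open>x\<^sub>1, \<dots>, x\<^sub>n\<close> is a regular sequence on \<open>R/c\<close>,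
    then a chain of primes of length \<open>n\<close> starts at \<open>P\<close>. For \<open>c = 0\<close> and \<open>n = d\<close> it follows that
    every associated prime \<open>P\<close> of \<open>R\<close> is minimal.

  \<^item> \<open>regseq_length_le_maximal\<close>: no regular sequence is longer than one after which \<open>\<mm>\<close> has become
    an associated prime. This makes the depth, and with it \<open>d\<close>, finite, and it shows that
    every regular element \<open>z\<close> of \<open>\<mm>\<close> starts a regular sequence of length at least \<open>d\<close>.

  \<^item> \<open>assoc_prime_of_regular_element_if_disconnected\<close>, the connectedness theorem in elementary
    form: if \<open>a\<close> and \<open>b\<close> are each other's annihilators and \<open>Q\<close> is minimal over \<open>a + b\<close>, then \<open>Q\<close> is
    an associated prime of \<open>R/z\<close> for every regular \<open>z \<in> Q\<close>.

  \<^item> \<open>minimal_over_assoc\<close>: minimal primes of \<open>c\<close> belong to \<open>Ass(R/c)\<close>. This is how the hypothesis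
    on \<open>I\<close> is brought to bear, and it is used to see that no minimal prime of \<open>R\<close>
    contains \<open>I + J\<close>.

  Let \<open>Q\<close> be minimal over \<open>I + J\<close>. It contains a minimal prime of \<open>I\<close>, which by hypothesis and the
  first result is a minimal prime of \<open>R\<close>, and it contains this prime properly. Hence
  \<open>dim R/Q \<le> d - 1\<close>. Also \<open>Q\<close> lies in no associated prime of \<open>R\<close>, so it contains a regular
  element \<open>z\<close>. The third result applies with \<open>a = (0 : J)\<close> and \<open>b = J\<close>, so \<open>Q \<in> Ass(R/z)\<close>; the second
  gives a regular sequence of length at least \<open>d - 1\<close> on \<open>R/z\<close>; and the first turns it into a chain
  of primes of that length above \<open>Q\<close>.
\<close>

section \<open>Associated primes of a quotient by an ideal\<close>

context cring begin

definition colon :: "'a set \<Rightarrow> 'a \<Rightarrow> 'a set" where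
  "colon c w = {r \<in> carrier R. r \<otimes> w \<in> c}"

text \<open>
  The associated primes of the module \<open>R/c\<close>, described by elements of \<open>R\<close>. Working with the ideal
  \<open>c\<close> in the fixed ring \<open>R\<close> makes it possible to vary \<open>c\<close> in inductions without changing the ring.
\<close>
definition assoc_primes :: "'a set \<Rightarrow> 'a set set" where
  "assoc_primes c = {P. primeideal P R \<and> (\<exists>w\<in>carrier R. P = colon c w)}"

text \<open>
  \<open>x\<close> is a nonzerodivisor on \<open>R/c\<close>.
\<close>
definition regular_mod :: "'a set \<Rightarrow> 'a \<Rightarrow> bool" where
  "regular_mod c x \<longleftrightarrow> x \<in> carrier R \<and> (\<forall>a\<in>carrier R. x \<otimes> a \<in> c \<longrightarrow> a \<in> c)"

abbreviation adjoin :: "'a set \<Rightarrow> 'a \<Rightarrow> 'a set" where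
  "adjoin c x \<equiv> c <+> PIdl x"

lemma ideal_add_iff:
  assumes "ideal d R" "a \<in> d" "b \<in> carrier R" shows "a \<oplus> b \<in> d \<longleftrightarrow> b \<in> d"
proof -
  interpret d: ideal d R by fact
  have "b = \<ominus> a \<oplus> (a \<oplus> b)" using d.Icarr[OF assms(2)] assms(3) by (simp add: r_neg1)
  then show ?thesis using assms(2) d.a_closed d.a_inv_closed by metis
qed

lemma adjoin_iff: "y \<in> adjoin c x \<longleftrightarrow> (\<exists>a\<in>c. \<exists>r\<in>carrier R. y = a \<oplus> r \<otimes> x)"
  by (auto simp: set_add_def' cgenideal_def)

lemma adjoin_ideal: "\<lbrakk>ideal c R; x \<in> carrier R\<rbrakk> \<Longrightarrow> ideal (adjoin c x) R"
  by (intro add_ideals cgenideal_ideal)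

lemma subset_adjoin: assumes "ideal c R" "x \<in> carrier R" shows "c \<subseteq> adjoin c x"
proof -
  interpret c: ideal c R by fact
  have "a = a \<oplus> \<zero> \<otimes> x" if "a \<in> c" for a using c.Icarr[OF that] assms(2) by simp
  then show ?thesis unfolding adjoin_iff subset_iff by blast
qed

lemma mem_adjoin: assumes "ideal c R" "x \<in> carrier R" shows "x \<in> adjoin c x"
proof -
  interpret c: ideal c R by fact
  have "x = \<zero> \<oplus> \<one> \<otimes> x" using assms(2) by simp
  then show ?thesis unfolding adjoin_iff using c.zero_closed by blast
qed

lemma mult_mem_adjoin:
  assumes "ideal c R" "x \<in> carrier R" "r \<in> carrier R" shows "r \<otimes> x \<in> adjoin c x"
  using ideal.I_l_closed[OF adjoin_ideal mem_adjoin] assms by blast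

lemma adjoin_subset: 
  assumes "ideal d R" "c \<subseteq> d" "x \<in> d" shows "adjoin c x \<subseteq> d"
proof -
  interpret d: ideal d R by fact
  show ?thesis using assms by (auto simp: adjoin_iff d.I_l_closed intro!: d.a_closed)
qed

lemma colon_ideal: assumes "ideal c R" "w \<in> carrier R" shows "ideal (colon c w) R"
proof -
  interpret c: ideal c R by fact
  show ?thesis
  proof (rule idealI[OF ring_axioms])
    show "subgroup (colon c w) (add_monoid R)"
    proof (rule add.subgroupI)
      have "\<zero> \<in> colon c w" using assms(2) by (simp add: colon_def)
      then show "colon c w \<noteq> {}" by blast
      show "\<ominus> a \<in> colon c w" if "a \<in> colon c w" for a
        using assms(2) that by (simp add: colon_def l_minus)
    qed (auto simp: colon_def assms(2) l_distr)
  next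
    fix a x assume "a \<in> colon c w" "x \<in> carrier R"
    then show "x \<otimes> a \<in> colon c w" by (auto simp: colon_def assms(2) m_assoc c.I_l_closed)
    then show "a \<otimes> x \<in> colon c w" using \<open>a \<in> colon c w\<close> \<open>x \<in> carrier R\<close> m_comm[of a x]
      by (simp add: colon_def)
  qed
qed

lemma subset_colon: assumes "ideal c R" "w \<in> carrier R" shows "c \<subseteq> colon c w"
  using ideal.I_r_closed[OF assms(1)] ideal.Icarr[OF assms(1)] assms(2) by (auto simp: colon_def)

lemma colon_mult_iff:
  assumes "t \<in> carrier R" "w \<in> carrier R"
  shows "x \<in> colon c (t \<otimes> w) \<longleftrightarrow> x \<in> carrier R \<and> x \<otimes> t \<in> colon c w"
  using assms by (auto simp: colon_def m_assoc)

lemma colon_subset_colon_mult: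
  assumes "ideal c R" "t \<in> carrier R" "w \<in> carrier R"
  shows "colon c w \<subseteq> colon c (t \<otimes> w)"
proof
  fix x assume "x \<in> colon c w"
  then have "x \<in> carrier R" "x \<otimes> t \<in> colon c w" 
    using ideal.I_r_closed[OF colon_ideal[OF assms(1,3)] _ assms(2)] by (auto simp: colon_def)
  then show "x \<in> colon c (t \<otimes> w)" using colon_mult_iff[OF assms(2,3)] by blast
qed

lemma primeideal_one: "primeideal P R \<Longrightarrow> \<one> \<notin> P"
  using ideal.one_imp_carrier primeideal.I_notcarr primeideal.axioms(1) by metis

lemma assoc_primes_prime: "P \<in> assoc_primes c \<Longrightarrow> primeideal P R"
  by (simp add: assoc_primes_def)

lemma assoc_primes_generator:
  assumes "P \<in> assoc_primes c" obtains w where "w \<in> carrier R" "P = colon c w" "w \<notin> c"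
proof -
  from assms obtain w where w: "w \<in> carrier R" "P = colon c w" "primeideal P R" by (auto simp: assoc_primes_def)
  then have "w \<notin> c" using primeideal_one by (force simp: colon_def)
  with w that show ?thesis by blast
qed

lemma assoc_primes_superset:
  assumes "ideal c R" "P \<in> assoc_primes c" shows "c \<subseteq> P"
  using assms by (auto elim!: assoc_primes_generator dest: subset_colon)

lemma regular_mod_notin_assoc:
  assumes "regular_mod c x" "P \<in> assoc_primes c" shows "x \<notin> P"
  using assms by (auto elim!: assoc_primes_generator simp: colon_def regular_mod_def)

lemma primeideal_nat_pow:
  assumes "primeideal P R" "x \<in> carrier R" "x [^] (n::nat) \<in> P" shows "x \<in> P"
  using assms(3)
proof (induction n)
  case 0 then show ?case using primeideal_one[OF assms(1)] by simp
next
  case (Suc n) then show ?case using primeideal.I_prime[OF assms(1), of "x [^] n" x] assms(2) by auto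
qed

end

section \<open>Existence and finiteness of associated primes\<close>

locale noetherian_cring = cring + noetherian_ring
begin

lemma ideals_maximal:
  assumes "S \<noteq> {}" "\<And>c. c \<in> S \<Longrightarrow> ideal c R"
  obtains M where "M \<in> S" "\<And>c. \<lbrakk>c \<in> S; M \<subseteq> c\<rbrakk> \<Longrightarrow> c = M"
proof -
  have "\<exists>M\<in>S. \<forall>c\<in>S. M \<subseteq> c \<longrightarrow> c = M"
  proof (rule subset_Zorn)
    fix C assume C: "subset.chain S C"
    show "\<exists>U\<in>S. \<forall>c\<in>C. c \<subseteq> U"
    proof (cases "C = {}")
      case False
      have "subset.chain {c. ideal c R} C" using C assms(2) unfolding pred_on.chain_def by auto
      then have "\<Union>C \<in> C" using ideal_chain_is_trivial[OF False] by blast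
      moreover have "C \<subseteq> S" using C unfolding pred_on.chain_def by (rule conjunct1)
      ultimately show ?thesis by (intro bexI[of _ "\<Union>C"] ballI Union_upper) (simp_all add: subsetD)
    qed (use assms(1) in auto)
  qed
  with that show thesis by blast
qed

text \<open>
  Among the proper ideals \<open>(c : rv)\<close> choose a maximal one; such an ideal is prime.
\<close>
lemma assoc_prime_exists:
  assumes c: "ideal c R" and v: "v \<in> carrier R" "v \<notin> c"
  obtains P where "P \<in> assoc_primes c" "colon c v \<subseteq> P"
proof -
  define S where "S = {colon c (r \<otimes> v) | r. r \<in> carrier R \<and> r \<otimes> v \<notin> c}"
  have "colon c (\<one> \<otimes> v) \<in> S" unfolding S_def using v by (intro CollectI exI[of _ \<one>]) simp
  moreover have "ideal d R" if "d \<in> S" for d using that v by (auto simp: S_def intro!: colon_ideal c)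
  ultimately obtain M where M: "M \<in> S" "\<And>d. \<lbrakk>d \<in> S; M \<subseteq> d\<rbrakk> \<Longrightarrow> d = M"
    using ideals_maximal[of S] by (metis empty_iff)
  from M(1) obtain r where r: "r \<in> carrier R" "r \<otimes> v \<notin> c" "M = colon c (r \<otimes> v)" by (auto simp: S_def)
  interpret c: ideal c R by fact
  have "primeideal M R"
  proof (rule primeidealI)
    show "ideal M R" using r v c colon_ideal by simp
    show "carrier R \<noteq> M" 
    proof
      assume "carrier R = M"
      then have "\<one> \<in> M" by blast
      then show False using r v by (auto simp: colon_def)
    qed
  next
    fix a b assume ab: "a \<in> carrier R" "b \<in> carrier R" "a \<otimes> b \<in> M"
    show "a \<in> M \<or> b \<in> M"
    proof (rule ccontr)
      assume *: "\<not> ?thesis"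
      then have "(b \<otimes> r) \<otimes> v \<notin> c" using r ab v by (auto simp: colon_def m_assoc)
      then have "colon c ((b \<otimes> r) \<otimes> v) \<in> S" unfolding S_def using ab r by blast
      moreover have "M \<subseteq> colon c ((b \<otimes> r) \<otimes> v)"
        using r ab v colon_subset_colon_mult[OF c, of b "r \<otimes> v"] by (simp add: m_assoc)
      ultimately have "colon c ((b \<otimes> r) \<otimes> v) = M" using M(2) by blast
      moreover have "a \<in> colon c ((b \<otimes> r) \<otimes> v)"
        using ab r v by (auto simp: colon_def m_assoc)
      ultimately show False using * by blast
    qed
  qed (rule is_cring)
  then have "M \<in> assoc_primes c" unfolding assoc_primes_def using r v m_closed by blast
  moreover have "colon c v \<subseteq> M" using r v colon_subset_colon_mult[OF c] by simp
  ultimately show thesis by (rule that)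
qed

lemma regular_mod_if_avoids:
  assumes "ideal c R" "x \<in> carrier R" "\<And>P. P \<in> assoc_primes c \<Longrightarrow> x \<notin> P"
  shows "regular_mod c x"
proof -
  have "a \<in> c" if a: "a \<in> carrier R" "x \<otimes> a \<in> c" for a
  proof (rule ccontr)
    assume "a \<notin> c"
    then obtain P where P: "P \<in> assoc_primes c" "colon c a \<subseteq> P"
      by (rule assoc_prime_exists[OF assms(1) a(1)])
    have "x \<in> colon c a" using a assms(2) by (simp add: colon_def)
    then show False using P assms(3) by blast
  qed
  then show ?thesis using assms by (auto simp: regular_mod_def)
qed

text \<open>
  Take an ideal \<open>d\<close> containing \<open>c\<close> that is maximal with the property that only finitely many primes have
  the form \<open>(c : w)\<close> with \<open>w \<in> d\<close>. If \<open>d \<noteq> R\<close>, choose a prime \<open>P = (d : v)\<close>. A prime \<open>(c : w)\<close> with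
  \<open>w \<in> d + Rv\<close> is either \<open>(c : tw)\<close> for some multiple \<open>tw \<in> d\<close>, or equal to \<open>P\<close>. So \<open>d + Rv\<close>
  has the property too, which contradicts the maximality of \<open>d\<close>.
\<close>
lemma finite_assoc_primes:
  assumes c: "ideal c R" shows "finite (assoc_primes c)"
proof -
  define A where "A d = {P. primeideal P R \<and> (\<exists>w\<in>d. P = colon c w)}" for d
  define S where "S = {d. ideal d R \<and> c \<subseteq> d \<and> finite (A d)}"
  interpret c: ideal c R by fact
  have "A c \<subseteq> {}"
  proof
  fix P assume "P \<in> A c"
    then obtain w where "w \<in> c" "P = colon c w" "primeideal P R" unfolding A_def by blast
    moreover then have "\<one> \<in> P" by (simp add: colon_def)
    ultimately show "P \<in> {}" using primeideal_one by blast
  qed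
  then have "c \<in> S" using c by (auto simp: S_def)
  moreover have "ideal d R" if "d \<in> S" for d using that by (simp add: S_def)
  ultimately obtain d where d: "d \<in> S" "\<And>e. \<lbrakk>e \<in> S; d \<subseteq> e\<rbrakk> \<Longrightarrow> e = d"
    using ideals_maximal[of S] by (metis empty_iff)
  from d(1) have di: "ideal d R" "c \<subseteq> d" "finite (A d)" by (auto simp: S_def)
  interpret d: ideal d R by fact
  have "d = carrier R"
  proof (rule ccontr)
    assume "d \<noteq> carrier R"
    then have "\<one> \<notin> d" using d.one_imp_carrier by blast
    then obtain P where Pd: "P \<in> assoc_primes d" by (rule assoc_prime_exists[OF di(1) one_closed])
    then have P: "primeideal P R" by (rule assoc_primes_prime)
    obtain v where v: "v \<in> carrier R" "P = colon d v" "v \<notin> d" 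
      by (rule assoc_primes_generator[OF Pd])
    have "A (adjoin d v) \<subseteq> insert P (A d)"
    proof
      fix P' assume "P' \<in> A (adjoin d v)"
      then obtain \<delta> r where P': "primeideal P' R" "P' = colon c (\<delta> \<oplus> r \<otimes> v)"
        and \<delta>: "\<delta> \<in> d" and r: "r \<in> carrier R" unfolding A_def Bex_def adjoin_iff by blast
      define w where "w = \<delta> \<oplus> r \<otimes> v"
      have w: "w \<in> carrier R" "P' = colon c w" using \<delta> r v P' by (auto simp: w_def)
      interpret P': primeideal P' R by fact
      show "P' \<in> insert P (A d)"
      proof (cases "\<exists>t\<in>carrier R - P'. t \<otimes> w \<in> d")
        case True
        then obtain t where t: "t \<in> carrier R" "t \<notin> P'" "t \<otimes> w \<in> d" by blast
        have "P' = colon c (t \<otimes> w)"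
        proof (intro equalityI subsetI)
          fix x assume "x \<in> P'"
          then show "x \<in> colon c (t \<otimes> w)"
            using colon_subset_colon_mult[OF c t(1) w(1)] w(2) by blast
        next
          fix x assume "x \<in> colon c (t \<otimes> w)"
          then have "x \<in> carrier R" "x \<otimes> t \<in> P'" using w(2) colon_mult_iff[OF t(1) w(1)] by blast+
          then show "x \<in> P'" using P'.I_prime t by blast
        qed
        then show ?thesis using t(3) P'(1) unfolding A_def by blast
      next
        case False
        have "P' = colon d w"
        proof (intro equalityI subsetI)
          fix x assume "x \<in> P'"
          then show "x \<in> colon d w" unfolding w(2) colon_def using di(2) by blast
        next
          fix x assume "x \<in> colon d w" then show "x \<in> P'" using False unfolding colon_def by blast
        qed
        also have eq: "colon d w = colon d (r \<otimes> v)"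
        proof -
          have "x \<otimes> w \<in> d \<longleftrightarrow> x \<otimes> (r \<otimes> v) \<in> d" if x: "x \<in> carrier R" for x
          proof -
            have xd: "x \<otimes> \<delta> \<in> d" using x \<delta> d.I_l_closed by blast
            have e: "x \<otimes> w = x \<otimes> \<delta> \<oplus> x \<otimes> (r \<otimes> v)" using x \<delta> r v by (simp add: w_def r_distr)
            show ?thesis unfolding e using ideal_add_iff[OF di(1) xd] x r v(1) by simp
          qed
          then show ?thesis unfolding colon_def by blast
        qed
        finally have e1: "P' = colon d (r \<otimes> v)" .
        have "r \<notin> P"
        proof
          assume "r \<in> P"
          then have "\<one> \<in> P'" using v(1,2) r unfolding e1 by (simp add: colon_def)
          then show False using primeideal_one P' by blast
        qed
        have "P' = P"
        proof (intro equalityI subsetI)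
          fix x assume "x \<in> P'"
          then have "x \<in> carrier R" "x \<otimes> r \<in> P" 
            unfolding e1 v(2) using colon_mult_iff[OF r v(1)] by blast+
          then show "x \<in> P" using primeideal.I_prime[OF P] r \<open>r \<notin> P\<close> by blast
        next
          fix x assume "x \<in> P"
          then show "x \<in> P'"
            unfolding e1 v(2) using colon_subset_colon_mult[OF di(1) r v(1)] by blast
        qed
        then show ?thesis by simp
      qed
    qed
    then have "finite (A (adjoin d v))" using di(3) finite_subset by blast
    moreover have sub: "d \<subseteq> adjoin d v" using subset_adjoin di(1) v(1) by blast
    ultimately have "adjoin d v \<in> S" using adjoin_ideal[OF di(1) v(1)] di(2) unfolding S_def by blast
    with sub have "adjoin d v = d" using d(2) by blast
    then show False using mem_adjoin di(1) v by blast
  qed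
  then have "assoc_primes c = A d" by (simp add: assoc_primes_def A_def)
  then show ?thesis using di(3) by simp
qed

end

context noetherian_cring
begin

section \<open>Prime avoidance\<close>

text \<open>
  By induction, for each \<open>P \<in> F\<close> there is \<open>z P \<in> d\<close> outside all other primes of \<open>F\<close>. If none of these
  elements works for \<open>F\<close> itself, then \<open>z P \<in> P\<close> throughout, \<open>F\<close> has at least two elements because \<open>d\<close> lies in no
  member of \<open>F\<close>, and \<open>z P + (\<Prod>\<^bsub>Q \<noteq> P\<^esub> z Q)\<close> works.
\<close>
lemma prime_avoidance:
  assumes "ideal d R" "finite F" "\<And>P. P \<in> F \<Longrightarrow> primeideal P R" "\<And>P. P \<in> F \<Longrightarrow> \<not> d \<subseteq> P"
  obtains z where "z \<in> d" "\<And>P. P \<in> F \<Longrightarrow> z \<notin> P"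
proof -
  interpret d: ideal d R by fact
  have "\<exists>z\<in>d. \<forall>P\<in>F. z \<notin> P" using assms(2-)
  proof (induction "card F" arbitrary: F)
    case 0
    then have "F = {}" by simp
    then show ?case using additive_subgroup.zero_closed[OF d.is_additive_subgroup] by blast
  next
    case (Suc n)
    have Fp: "primeideal P R" "\<not> d \<subseteq> P" if "P \<in> F" for P using Suc that by blast+
    have "\<exists>z\<in>d. \<forall>Q\<in>F - {P}. z \<notin> Q" if P: "P \<in> F" for P
    proof (rule Suc.hyps(1))
      show "n = card (F - {P})" using Suc.hyps(2) Suc.prems(1) P by simp
    qed (use Suc.prems in auto)
    then obtain z where z: "\<And>P. P \<in> F \<Longrightarrow> z P \<in> d" "\<And>P Q. \<lbrakk>P \<in> F; Q \<in> F; Q \<noteq> P\<rbrakk> \<Longrightarrow> z P \<notin> Q"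
      by (metis Diff_iff singletonD)
    show ?case
    proof (rule ccontr)
      assume neg: "\<not> ?case"
      have zP: "z P \<in> P" if "P \<in> F" for P using neg z that by blast
      have "F \<noteq> {}" using Suc.hyps(2) by auto
      then obtain P where P: "P \<in> F" by blast
      interpret P: primeideal P R using Fp P by blast
      show False
      proof (cases "F = {P}")
        case True
        then show False using neg Fp(2)[OF P] by blast
      next
        case False
        have carr: "z Q \<in> carrier R" if "Q \<in> F" for Q using z(1)[OF that] d.Icarr by blast
        have fin: "finite (F - {P})" using Suc.prems by simp
        have prod: "(\<Otimes>Q\<in>G. z Q) \<in> carrier R \<and> (\<Otimes>Q\<in>G. z Q) \<notin> P \<and> (\<forall>Q\<in>G. (\<Otimes>Q\<in>G. z Q) \<in> Q) \<and> (G \<noteq> {} \<longrightarrow> (\<Otimes>Q\<in>G. z Q) \<in> d)"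
          if "finite G" "G \<subseteq> F - {P}" for G using that
        proof (induction G)
          case empty
          then show ?case using primeideal_one P.primeideal by simp
        next
          case (insert Q G)
          define g where "g = (\<Otimes>Q\<in>G. z Q)"
          have g: "g \<in> carrier R" "g \<notin> P" "\<And>Q. Q \<in> G \<Longrightarrow> g \<in> Q" using insert g_def by auto
          have Q: "Q \<in> F" "Q \<noteq> P" using insert by auto
          have eq: "(\<Otimes>Q\<in>insert Q G. z Q) = z Q \<otimes> g"
            unfolding g_def using insert carr by (subst finprod_insert) auto
          have zQ: "z Q \<in> carrier R" "z Q \<in> d" "z Q \<in> Q" "z Q \<notin> P" using carr z zP Q P by auto
          have "z Q \<otimes> g \<notin> P" using P.I_prime zQ g by blast
          moreover have "z Q \<otimes> g \<in> Q'" if "Q' \<in> insert Q G" for Q'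
          proof -
            interpret Q': ideal Q' R using Fp(1) that insert.prems primeideal.axioms(1) by blast
            show ?thesis using that zQ g Q'.I_l_closed Q'.I_r_closed by blast
          qed
          ultimately show ?case unfolding eq using zQ g d.I_r_closed by simp
        qed
        define g where "g = (\<Otimes>Q\<in>F - {P}. z Q)"
        have g: "g \<in> carrier R" "g \<notin> P" "\<And>Q. Q \<in> F - {P} \<Longrightarrow> g \<in> Q" "g \<in> d"
          using prod[OF fin] False P unfolding g_def by blast+
        have zPd: "z P \<in> carrier R" "z P \<in> d" using z P carr by auto
        have "z P \<oplus> g \<notin> Q" if Q: "Q \<in> F" for Q
        proof -
          interpret Q: primeideal Q R using Fp Q by blast
          show ?thesis
          proof (cases "Q = P")
            case True
            then show ?thesis using ideal_add_iff[OF P.is_ideal zP[OF P] g(1)] g(2) by simp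
          next
            case False
            then have "g \<in> Q" "z P \<notin> Q" using Q g z(2) P by auto
            then show ?thesis using ideal_add_iff[OF Q.is_ideal _ zPd(1), of g] a_comm[OF zPd(1) g(1)] by simp
          qed
        qed
        moreover have "z P \<oplus> g \<in> d" using zPd g by simp
        ultimately show False using neg by blast
      qed
    qed
  qed
  then show thesis using that by blast
qed

lemma regular_element_exists:
  assumes d: "ideal d R" and C: "finite C" "\<And>c. c \<in> C \<Longrightarrow> ideal c R"
    and nd: "\<And>c P. \<lbrakk>c \<in> C; P \<in> assoc_primes c\<rbrakk> \<Longrightarrow> \<not> d \<subseteq> P"
  obtains z where "z \<in> d" "\<And>c. c \<in> C \<Longrightarrow> regular_mod c z"
proof -
  have fin: "finite (\<Union>c\<in>C. assoc_primes c)" using C finite_assoc_primes by blast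
  obtain z where z: "z \<in> d" "\<And>P. P \<in> (\<Union>c\<in>C. assoc_primes c) \<Longrightarrow> z \<notin> P"
  proof (rule prime_avoidance[OF d fin])
    show "\<And>P. P \<in> (\<Union>c\<in>C. assoc_primes c) \<Longrightarrow> primeideal P R" using assoc_primes_prime by blast
    show "\<And>P. P \<in> (\<Union>c\<in>C. assoc_primes c) \<Longrightarrow> \<not> d \<subseteq> P" using nd by blast
  qed blast
  have "regular_mod c z" if c: "c \<in> C" for c
  proof (rule regular_mod_if_avoids[OF C(2)[OF c]])
    show "z \<in> carrier R" using ideal.Icarr[OF d z(1)] .
    show "\<And>P. P \<in> assoc_primes c \<Longrightarrow> z \<notin> P" using z(2) c by blast
  qed
  with z(1) that show thesis by blast
qed

section \<open>Recognising associated primes\<close>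

text \<open>
  The hypotheses say that the image of \<open>v\<close> in the localisation of \<open>R/c\<close> at \<open>Q\<close> is nonzero and is killed
  there by a power of each element of \<open>Q\<close>. Among the multiples \<open>w\<close> of \<open>v\<close> that stay nonzero in the
  localisation, choose one with \<open>(c : w)\<close> maximal; then \<open>(c : w) = Q\<close>. Indeed \<open>(c : w) \<subseteq> Q\<close> is clear.
  Let \<open>x \<in> Q\<close>. If \<open>xw\<close> vanishes in the localisation, then \<open>x \<in> (c : tw) = (c : w)\<close> for
  some \<open>t \<notin> Q\<close>. Otherwise \<open>(c : xw) = (c : w)\<close>, and then no power of \<open>x\<close> kills \<open>w\<close> there.
\<close>
lemma assoc_prime_if_locally_nilpotent:
  assumes c: "ideal c R" and Q: "primeideal Q R" and v: "v \<in> carrier R"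
    and nz: "\<And>t. \<lbrakk>t \<in> carrier R; t \<notin> Q\<rbrakk> \<Longrightarrow> t \<otimes> v \<notin> c"
    and nil: "\<And>x. x \<in> Q \<Longrightarrow> \<exists>t\<in>carrier R - Q. \<exists>k::nat. t \<otimes> (x [^] k \<otimes> v) \<in> c"
  shows "Q \<in> assoc_primes c"
proof -
  interpret Q: primeideal Q R by fact
  interpret c: ideal c R by fact
  define good where "good w \<longleftrightarrow> w \<in> carrier R \<and> (\<exists>r\<in>carrier R. w = r \<otimes> v) \<and> (\<forall>t\<in>carrier R - Q. t \<otimes> w \<notin> c)" for w
  define S where "S = colon c ` Collect good"
  have "good v" unfolding good_def using v nz by (auto intro: bexI[of _ \<one>])
  then have "S \<noteq> {}" unfolding S_def by blast
  moreover have "ideal d R" if "d \<in> S" for d using that colon_ideal[OF c] unfolding S_def good_def by blast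
  ultimately obtain M where M: "M \<in> S" "\<And>d. \<lbrakk>d \<in> S; M \<subseteq> d\<rbrakk> \<Longrightarrow> d = M"
    using ideals_maximal[of S] by (metis empty_iff)
  from M(1) obtain w where w: "good w" "M = colon c w" unfolding S_def by blast
  then obtain r where wc: "w \<in> carrier R" and r: "r \<in> carrier R" "w = r \<otimes> v" unfolding good_def by blast
  have nw: "t \<otimes> w \<notin> c" if "t \<in> carrier R" "t \<notin> Q" for t using w(1) that unfolding good_def by blast
  have max: "colon c (t \<otimes> w) = colon c w" if "good (t \<otimes> w)" "t \<in> carrier R" for t
    using M(2)[of "colon c (t \<otimes> w)"] that colon_subset_colon_mult[OF c that(2) wc] w(2) unfolding S_def by blast
  have "colon c w \<subseteq> Q" using nw unfolding colon_def by blast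
  moreover have "Q \<subseteq> colon c w"
  proof
    fix x assume xQ: "x \<in> Q"
    then have x: "x \<in> carrier R" by simp
    have unit: "x \<in> colon c w" if t: "t \<in> carrier R" "t \<notin> Q" "t \<otimes> (x \<otimes> w) \<in> c" for t
    proof -
      have "good (t \<otimes> w)" unfolding good_def
      proof (intro conjI ballI)
        show "t \<otimes> w \<in> carrier R" using t wc by simp
        show "\<exists>r\<in>carrier R. t \<otimes> w = r \<otimes> v" using r t v by (intro bexI[of _ "t \<otimes> r"]) (simp_all add: m_assoc)
        fix s assume "s \<in> carrier R - Q"
        then have s: "s \<in> carrier R" "s \<notin> Q" by auto
        then have "s \<otimes> t \<notin> Q" using t Q.I_prime by blast
        then have "(s \<otimes> t) \<otimes> w \<notin> c" using nw s t by blast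
        then show "s \<otimes> (t \<otimes> w) \<notin> c" using s t wc by (simp add: m_assoc)
      qed
      then have "colon c (t \<otimes> w) = colon c w" using max t by blast
      moreover have "x \<in> colon c (t \<otimes> w)"
        using t(3) m_lcomm[OF x t(1) wc] x by (simp add: colon_def)
      ultimately show ?thesis by simp
    qed
    show "x \<in> colon c w"
    proof (rule ccontr)
      assume neg: "x \<notin> colon c w"
      have "good (x \<otimes> w)" unfolding good_def
      proof (intro conjI ballI)
        show "x \<otimes> w \<in> carrier R" using x wc by simp
        show "\<exists>r\<in>carrier R. x \<otimes> w = r \<otimes> v" using r x v by (intro bexI[of _ "x \<otimes> r"]) (simp_all add: m_assoc)
        show "s \<otimes> (x \<otimes> w) \<notin> c" if "s \<in> carrier R - Q" for s using neg unit that by blast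
      qed
      then have eq: "colon c (x \<otimes> w) = colon c w" using max x by blast
      have pow: "t \<otimes> (x [^] (k::nat) \<otimes> w) \<notin> c" if t: "t \<in> carrier R" "t \<notin> Q" for k t
      proof (induction k)
        case 0 then show ?case using nw t wc by simp
      next
        case (Suc k)
        have a: "t \<otimes> x [^] k \<notin> colon c w" using Suc t x wc by (simp add: colon_def m_assoc)
        have "t \<otimes> x [^] k \<in> carrier R" using t x by simp
        then have "(t \<otimes> x [^] k) \<otimes> (x \<otimes> w) \<notin> c" using a unfolding eq[symmetric] by (simp add: colon_def)
        then show ?case using t x wc by (simp add: m_assoc)
      qed
      obtain t k where t: "t \<in> carrier R" "t \<notin> Q" "t \<otimes> (x [^] (k::nat) \<otimes> v) \<in> c" using nil[OF xQ] by blast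
      have "t \<otimes> (x [^] k \<otimes> w) = r \<otimes> (t \<otimes> (x [^] k \<otimes> v))" unfolding r(2) using r(1) t(1) x v by (simp add: m_ac)
      then have "t \<otimes> (x [^] k \<otimes> w) \<in> c" using t(3) c.I_l_closed r(1) by simp
      then show False using pow t by blast
    qed
  qed
  ultimately have "Q = colon c w" by blast
  then show ?thesis using wc Q unfolding assoc_primes_def by blast
qed

definition minimal_over :: "'a set \<Rightarrow> 'a set \<Rightarrow> bool" where
  "minimal_over c Q \<longleftrightarrow> primeideal Q R \<and> c \<subseteq> Q \<and> (\<forall>P. primeideal P R \<and> c \<subseteq> P \<and> P \<subseteq> Q \<longrightarrow> P = Q)"

text \<open>
  In the localisation at \<open>Q\<close> the radical of \<open>c\<close> is \<open>Q\<close>. To see this without localising, let \<open>c'\<close> be the ideal of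
  all \<open>r\<close> with \<open>r t x\<^sup>k \<in> c\<close> for some \<open>t \<notin> Q\<close> and some \<open>k\<close>. If \<open>c'\<close> were proper, then an associated prime of
  \<open>R/c'\<close> would lie between \<open>c\<close> and \<open>Q\<close> without containing \<open>x\<close>.
\<close>
lemma minimal_over_nilpotent:
  assumes c: "ideal c R" and Q: "minimal_over c Q" and x: "x \<in> Q"
  shows "\<exists>t\<in>carrier R - Q. \<exists>k::nat. t \<otimes> x [^] k \<in> c"
proof (rule ccontr)
  assume neg: "\<not> ?thesis"
  interpret c: ideal c R by fact
  interpret Q: primeideal Q R using Q minimal_over_def by blast
  have xc: "x \<in> carrier R" using x by simp
  define c' where "c' = {r \<in> carrier R. \<exists>t\<in>carrier R - Q. \<exists>k::nat. r \<otimes> (t \<otimes> x [^] k) \<in> c}"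
  have "ideal c' R"
  proof (rule idealI[OF ring_axioms])
    show "subgroup c' (add_monoid R)"
    proof (rule add.subgroupI)
      show "c' \<subseteq> carrier R" unfolding c'_def by blast
      have "\<zero> \<otimes> (\<one> \<otimes> x [^] (0::nat)) \<in> c" by simp
      moreover have "\<one> \<in> carrier R - Q" using primeideal_one Q.primeideal by blast
      ultimately show "c' \<noteq> {}" unfolding c'_def by blast
      show "\<ominus> a \<in> c'" if "a \<in> c'" for a
      proof -
        from that obtain t k where t: "a \<in> carrier R" "t \<in> carrier R - Q" "a \<otimes> (t \<otimes> x [^] (k::nat)) \<in> c" 
          unfolding c'_def by blast
        then have "\<ominus> a \<otimes> (t \<otimes> x [^] k) \<in> c" using xc by (simp add: l_minus)
        then show ?thesis unfolding c'_def using t a_inv_closed by blast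
      qed
      show "a \<oplus> b \<in> c'" if "a \<in> c'" "b \<in> c'" for a b
      proof -
        from that(1) obtain t k where t: "a \<in> carrier R" "t \<in> carrier R - Q" "a \<otimes> (t \<otimes> x [^] (k::nat)) \<in> c" 
          unfolding c'_def by blast
        from that(2) obtain s l where s: "b \<in> carrier R" "s \<in> carrier R - Q" "b \<otimes> (s \<otimes> x [^] (l::nat)) \<in> c" 
          unfolding c'_def by blast
        have sc: "s \<in> carrier R" "t \<in> carrier R" "x [^] k \<in> carrier R" "x [^] l \<in> carrier R" using s t xc by auto
        have "(a \<oplus> b) \<otimes> ((s \<otimes> t) \<otimes> x [^] (k + l)) = 
           (s \<otimes> x [^] l) \<otimes> (a \<otimes> (t \<otimes> x [^] k)) \<oplus> (t \<otimes> x [^] k) \<otimes> (b \<otimes> (s \<otimes> x [^] l))"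
          unfolding nat_pow_mult[OF xc, symmetric] using sc t(1) s(1) by algebra
        moreover have "(s \<otimes> x [^] l) \<otimes> (a \<otimes> (t \<otimes> x [^] k)) \<in> c" using t(3) sc c.I_l_closed by simp
        moreover have "(t \<otimes> x [^] k) \<otimes> (b \<otimes> (s \<otimes> x [^] l)) \<in> c" using s(3) sc c.I_l_closed by simp
        ultimately have "(a \<oplus> b) \<otimes> ((s \<otimes> t) \<otimes> x [^] (k + l)) \<in> c" by simp
        moreover have "s \<otimes> t \<in> carrier R - Q" using s t Q.I_prime by blast
        ultimately show ?thesis unfolding c'_def using s(1) t(1) a_closed by blast
      qed
    qed
  next
    fix a r assume a: "a \<in> c'" and r: "r \<in> carrier R"
    from a obtain t k where t: "a \<in> carrier R" "t \<in> carrier R - Q" "a \<otimes> (t \<otimes> x [^] (k::nat)) \<in> c" 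
      unfolding c'_def by blast
    have "(r \<otimes> a) \<otimes> (t \<otimes> x [^] k) = r \<otimes> (a \<otimes> (t \<otimes> x [^] k))" using t r xc by (simp add: m_assoc)
    then have "(r \<otimes> a) \<otimes> (t \<otimes> x [^] k) \<in> c" using c.I_l_closed[OF t(3) r] by simp
    then show "r \<otimes> a \<in> c'" unfolding c'_def using t r m_closed by blast
    then show "a \<otimes> r \<in> c'" using m_comm t r by simp
  qed
  moreover have "\<one> \<notin> c'" using neg xc unfolding c'_def by auto
  ultimately obtain P where P: "P \<in> assoc_primes c'" using assoc_prime_exists[of c' \<one>] by blast
  obtain w where w: "w \<in> carrier R" "P = colon c' w" "w \<notin> c'" by (rule assoc_primes_generator[OF P])
  have "c \<subseteq> c'"
  proof
    fix a assume a: "a \<in> c"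
    then have "a \<otimes> (\<one> \<otimes> x [^] (0::nat)) \<in> c" by simp
    moreover have "\<one> \<in> carrier R - Q" using primeideal_one Q.primeideal by blast
    ultimately show "a \<in> c'" unfolding c'_def using a c.Icarr by blast
  qed
  then have "c \<subseteq> P" using assoc_primes_superset[OF \<open>ideal c' R\<close> P] by blast
  moreover have "P \<subseteq> Q"
  proof (rule ccontr)
    assume "\<not> P \<subseteq> Q"
    then obtain s where s: "s \<in> carrier R" "s \<notin> Q" "s \<otimes> w \<in> c'" unfolding w(2) colon_def by blast
    then obtain t k where t: "t \<in> carrier R - Q" "(s \<otimes> w) \<otimes> (t \<otimes> x [^] (k::nat)) \<in> c" unfolding c'_def by blast
    then have "w \<otimes> ((s \<otimes> t) \<otimes> x [^] k) \<in> c" using s(1) w(1) xc m_lcomm[of s w] by (simp add: m_assoc)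
    moreover have "s \<otimes> t \<in> carrier R - Q" using s t Q.I_prime by blast
    ultimately show False using w(1,3) unfolding c'_def by blast
  qed
  moreover have "primeideal P R" using P by (rule assoc_primes_prime)
  ultimately have "P = Q" using Q unfolding minimal_over_def by blast
  then have "x \<otimes> w \<in> c'" using x unfolding w(2) colon_def by blast
  then obtain t k where t: "t \<in> carrier R - Q" "(x \<otimes> w) \<otimes> (t \<otimes> x [^] (k::nat)) \<in> c" unfolding c'_def by blast
  have "(x \<otimes> w) \<otimes> (t \<otimes> x [^] k) = w \<otimes> (t \<otimes> x [^] Suc k)" using t(1) xc w(1) m_comm[of x]
    by (simp add: m_assoc)
  then have "w \<otimes> (t \<otimes> x [^] Suc k) \<in> c" using t(2) by simp
  then show False using w(1,3) t(1) unfolding c'_def by blast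
qed

lemma minimal_over_assoc:
  assumes c: "ideal c R" and Q: "minimal_over c Q"
  shows "Q \<in> assoc_primes c"
proof (rule assoc_prime_if_locally_nilpotent[OF c])
  interpret Q: primeideal Q R using Q minimal_over_def by blast
  show "primeideal Q R" ..
  show "t \<otimes> \<one> \<notin> c" if "t \<in> carrier R" "t \<notin> Q" for t using that Q unfolding minimal_over_def by auto
  show "\<exists>t\<in>carrier R - Q. \<exists>k::nat. t \<otimes> (x [^] k \<otimes> \<one>) \<in> c" if "x \<in> Q" for x
    using minimal_over_nilpotent[OF c Q that] Q.Icarr[OF that] by simp
qed simp

end

section \<open>Chains of primes\<close>

text \<open>
  For an ideal \<open>A\<close> this says \<open>dim R/A \<ge> n\<close>. The set \<open>A\<close> may also be
  empty, and then the chains are those in the definition of the dimension of \<open>R\<close>.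
\<close>
definition prime_chain_above :: "('a, 'b) ring_scheme \<Rightarrow> 'a set \<Rightarrow> nat \<Rightarrow> bool" where
  "prime_chain_above R A n \<longleftrightarrow>
     (\<exists>p. (\<forall>i\<le>n. primeideal (p i) R) \<and> (\<forall>i<n. p i \<subset> p (Suc i)) \<and> A \<subseteq> p 0)"

lemma prime_chain_above_0: "primeideal P R \<Longrightarrow> A \<subseteq> P \<Longrightarrow> prime_chain_above R A 0"
  unfolding prime_chain_above_def by (rule exI[of _ "\<lambda>_. P"]) simp

lemma prime_chain_above_Suc:
  assumes "prime_chain_above R Q n" "primeideal P R" "P \<subset> Q"
  shows "prime_chain_above R P (Suc n)"
proof -
  obtain p where p: "\<And>i. i \<le> n \<Longrightarrow> primeideal (p i) R" "\<And>i. i < n \<Longrightarrow> p i \<subset> p (Suc i)" "Q \<subseteq> p 0"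
    using assms(1) unfolding prime_chain_above_def by blast
  define p' where "p' i = (case i of 0 \<Rightarrow> P | Suc j \<Rightarrow> p j)" for i
  have "primeideal (p' i) R" if "i \<le> Suc n" for i
    using that assms(2) p(1) by (cases i) (simp_all add: p'_def)
  moreover have "p' i \<subset> p' (Suc i)" if "i < Suc n" for i
    using that assms(3) p(2,3) by (cases i) (auto simp: p'_def)
  ultimately show ?thesis unfolding prime_chain_above_def using p(3) assms(3)
    by (intro exI[of _ p'] conjI allI impI) (auto simp: p'_def)
qed

context noetherian_cring
begin

section \<open>Regular elements modulo an ideal\<close>

lemma adjoin_commute:
  assumes c: "ideal c R" and y: "y \<in> carrier R" and z: "z \<in> carrier R"
  shows "adjoin (adjoin c y) z = adjoin (adjoin c z) y"
proof -
  have "adjoin (adjoin c y) z \<subseteq> adjoin (adjoin c z) y" if y: "y \<in> carrier R" and z: "z \<in> carrier R" for y z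
  proof -
    have i: "ideal (adjoin c z) R" "ideal (adjoin (adjoin c z) y) R" using adjoin_ideal c y z by blast+
    show ?thesis
    proof (intro adjoin_subset[OF i(2)])
      show "c \<subseteq> adjoin (adjoin c z) y" using subset_adjoin[OF i(1) y] subset_adjoin[OF c z] by blast
      show "y \<in> adjoin (adjoin c z) y" using mem_adjoin i y by blast
      show "z \<in> adjoin (adjoin c z) y" using mem_adjoin[OF c z] subset_adjoin[OF i(1) y] by blast
    qed
  qed
  then show ?thesis using y z by blast
qed

lemma regular_modD:
  "\<lbrakk>regular_mod c x; a \<in> carrier R; x \<otimes> a \<in> c\<rbrakk> \<Longrightarrow> a \<in> c"
  unfolding regular_mod_def by blast

text \<open>
  Writing \<open>ya = b + rz\<close> with \<open>b \<in> c\<close>, regularity of \<open>z\<close> modulo \<open>c + Ry\<close> gives \<open>r = b' + sy\<close> with \<open>b' \<in> c\<close>; then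
  \<open>y(a - sz) \<in> c\<close>, and so \<open>a - sz \<in> c\<close>.
\<close>
lemma regular_mod_swap:
  assumes c: "ideal c R" and y: "regular_mod c y" and z: "regular_mod (adjoin c y) z"
  shows "regular_mod (adjoin c z) y"
proof -
  interpret c: ideal c R by fact
  have yz: "y \<in> carrier R" "z \<in> carrier R" using y z unfolding regular_mod_def by blast+
  have "a \<in> adjoin c z" if a: "a \<in> carrier R" "y \<otimes> a \<in> adjoin c z" for a
  proof -
    obtain b r where br: "b \<in> c" "r \<in> carrier R" "y \<otimes> a = b \<oplus> r \<otimes> z" using a(2) unfolding adjoin_iff by blast
    have bc: "b \<in> carrier R" using br by simp
    have "z \<otimes> r = \<ominus> b \<oplus> a \<otimes> y" using br bc a yz m_comm[of a y] m_comm[of z r] by (simp add: r_neg1)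
    then have "z \<otimes> r \<in> adjoin c y" unfolding adjoin_iff using br(1) a(1) c.a_inv_closed by blast
    then have "r \<in> adjoin c y" using regular_modD[OF z br(2)] by blast
    then obtain b' s where bs: "b' \<in> c" "s \<in> carrier R" "r = b' \<oplus> s \<otimes> y" unfolding adjoin_iff by blast
    have b'c: "b' \<in> carrier R" using bs by simp
    have "y \<otimes> (a \<ominus> s \<otimes> z) = y \<otimes> a \<ominus> s \<otimes> y \<otimes> z" using yz a bs(2) by algebra
    also have "\<dots> = b \<oplus> b' \<otimes> z" unfolding br(3) bs(3) using yz bs(2) bc b'c by algebra
    finally have "y \<otimes> (a \<ominus> s \<otimes> z) \<in> c" using br(1) bs(1) c.I_r_closed yz by simp
    then have "a \<ominus> s \<otimes> z \<in> c" by (rule regular_modD[OF y, rotated]) (use a(1) bs(2) yz(2) in simp)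
    moreover have "a = (a \<ominus> s \<otimes> z) \<oplus> s \<otimes> z" using a bs(2) yz by algebra
    ultimately show ?thesis unfolding adjoin_iff using bs(2) by blast
  qed
  then show ?thesis using yz unfolding regular_mod_def by blast
qed

text \<open>
  Let \<open>Q = (c + Rx : u)\<close>. As \<open>z \<in> Q\<close>, there is \<open>v\<close> with \<open>zu \<equiv> vx\<close> modulo \<open>c\<close>. This relation is symmetric
  in \<open>(x, u)\<close> and \<open>(z, v)\<close>, and it implies \<open>(c + Rx : u) = (c + Rz : v)\<close>.
\<close>
lemma assoc_prime_exchange:
  assumes c: "ideal c R" and x: "regular_mod c x" and z: "regular_mod c z"
    and Q: "Q \<in> assoc_primes (adjoin c x)" "z \<in> Q"
  shows "Q \<in> assoc_primes (adjoin c z)"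
proof -
  interpret c: ideal c R by fact
  have xz: "x \<in> carrier R" "z \<in> carrier R" using x z unfolding regular_mod_def by blast+
  obtain u where u: "u \<in> carrier R" "Q = colon (adjoin c x) u" 
    by (rule assoc_primes_generator[OF Q(1)])
  have "z \<otimes> u \<in> adjoin c x" using Q(2) unfolding u(2) colon_def by blast
  then obtain a v where av: "a \<in> c" "v \<in> carrier R" "z \<otimes> u = a \<oplus> v \<otimes> x" unfolding adjoin_iff by blast
  have ac: "a \<in> carrier R" using av by simp
  have *: "t \<otimes> v \<in> adjoin c z"
    if tu: "t \<otimes> u \<in> adjoin c x" and x: "regular_mod c x" and av: "a \<in> c" "z \<otimes> u = a \<oplus> v \<otimes> x"
      and carr: "t \<in> carrier R" "u \<in> carrier R" "v \<in> carrier R" "x \<in> carrier R" "z \<in> carrier R"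
    for t u v x z a
  proof -
    obtain b r where br: "b \<in> c" "r \<in> carrier R" "t \<otimes> u = b \<oplus> r \<otimes> x" using tu unfolding adjoin_iff by blast
    have abc: "a \<in> carrier R" "b \<in> carrier R" using br av by simp_all
    have "x \<otimes> (t \<otimes> v \<ominus> r \<otimes> z) = t \<otimes> (a \<oplus> v \<otimes> x) \<ominus> z \<otimes> (r \<otimes> x) \<ominus> t \<otimes> a" using carr abc br(2) by algebra
    also have "\<dots> = z \<otimes> (t \<otimes> u) \<ominus> z \<otimes> (r \<otimes> x) \<ominus> t \<otimes> a" unfolding av(2)[symmetric] using carr by (simp add: m_ac)
    also have "\<dots> = z \<otimes> b \<ominus> t \<otimes> a" unfolding br(3) using carr abc br(2) by algebra
    finally have "x \<otimes> (t \<otimes> v \<ominus> r \<otimes> z) \<in> c" using br(1) av(1) c.I_l_closed carr by (simp add: minus_eq)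
    then have "t \<otimes> v \<ominus> r \<otimes> z \<in> c" by (rule regular_modD[OF x, rotated]) (use carr br(2) in simp)
    moreover have "t \<otimes> v = (t \<otimes> v \<ominus> r \<otimes> z) \<oplus> r \<otimes> z" using carr br(2) by algebra
    ultimately show ?thesis unfolding adjoin_iff using br(2) by blast
  qed
  have "x \<otimes> v = \<ominus> a \<oplus> u \<otimes> z" 
  proof -
    have "x \<otimes> v = \<ominus> a \<oplus> (a \<oplus> v \<otimes> x)" using ac av(2) xz m_comm[of x v] by (simp add: r_neg1)
    then show ?thesis unfolding av(3)[symmetric] using m_comm[OF xz(2) u(1)] by simp
  qed
  then have "t \<otimes> v \<in> adjoin c z \<longleftrightarrow> t \<otimes> u \<in> adjoin c x" if "t \<in> carrier R" for t
    using *[OF _ x av(1,3) that u(1) av(2) xz] *[OF _ z _ _ that av(2) u(1) xz(2,1), of "\<ominus> a"] av(1) c.a_inv_closed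
    by blast
  then have "Q = colon (adjoin c z) v" unfolding u(2) colon_def by blast
  then show ?thesis using assoc_primes_prime[OF Q(1)] av(2) unfolding assoc_primes_def by blast
qed

end

section \<open>Regular sequences in a local ring\<close>

context noetherian_local_ring
begin

sublocale noetherian_cring ..

lemma m_ideal: "ideal \<mm> R" using maximal by (rule maximalideal.axioms)

lemma one_notin_m: "\<one> \<notin> \<mm>"
  using maximal ideal.one_imp_carrier[OF m_ideal] maximalideal.I_notcarr by blast

lemma m_prime: "primeideal \<mm> R" using maximal by (rule maximalideal_prime)

lemma proper_ideal_subset_m:
  assumes c: "ideal c R" "\<one> \<notin> c" shows "c \<subseteq> \<mm>"
proof -
  define S where "S = {d. ideal d R \<and> c \<subseteq> d \<and> \<one> \<notin> d}"
  have "S \<noteq> {}" using c unfolding S_def by blast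
  moreover have "ideal d R" if "d \<in> S" for d using that unfolding S_def by blast
  ultimately obtain M where M: "M \<in> S" "\<And>d. \<lbrakk>d \<in> S; M \<subseteq> d\<rbrakk> \<Longrightarrow> d = M"
    using ideals_maximal[of S] by (metis empty_iff)
  have "maximalideal M R"
  proof (rule maximalidealI)
    show "ideal M R" "carrier R \<noteq> M" using M(1) unfolding S_def by auto
    fix J assume J: "ideal J R" "M \<subseteq> J" "J \<subseteq> carrier R"
    show "J = M \<or> J = carrier R"
    proof (cases "\<one> \<in> J")
      case True
      then show ?thesis using ideal.one_imp_carrier J(1) by blast
    next
      case False
      then have "J \<in> S" using J M(1) unfolding S_def by blast
      then show ?thesis using M(2) J(2) by blast
    qed
  qed
  then have "M = \<mm>" by (rule unique_maximal)
  then show ?thesis using M(1) unfolding S_def by blast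
qed

text \<open>
  \<open>1 - x\<close> is a unit of the local ring.
\<close>
lemma one_minus_cancel:
  assumes c: "ideal c R" and x: "x \<in> \<mm>" and r: "r \<in> carrier R" "(\<one> \<ominus> x) \<otimes> r \<in> c"
  shows "r \<in> c"
proof (rule ccontr)
  assume "r \<notin> c"
  interpret m: ideal \<mm> R by (rule m_ideal)
  have xc: "x \<in> carrier R" using x by simp
  have "\<one> \<notin> colon c r" using r \<open>r \<notin> c\<close> by (simp add: colon_def)
  then have "colon c r \<subseteq> \<mm>" by (rule proper_ideal_subset_m[OF colon_ideal[OF c r(1)]])
  then have "\<one> \<ominus> x \<in> \<mm>" using r xc unfolding colon_def by auto
  moreover have "\<one> = x \<oplus> (\<one> \<ominus> x)" using xc by algebra
  ultimately show False using one_notin_m m.a_closed x by metis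
qed

text \<open>
  Let \<open>N\<close> be the ideal of elements that multiply \<open>P\<close> into \<open>c\<close>; it is larger than \<open>c\<close>. If \<open>N\<close> were contained in
  \<open>c + Rx\<close>, then \<open>N = c + xN\<close> by regularity of \<open>x\<close>, and Nakayama's lemma would give \<open>N = c\<close>. So some
  \<open>v \<in> N\<close> lies outside \<open>c + Rx\<close>; the ideal \<open>(c + Rx : v)\<close> contains \<open>P\<close> and \<open>x\<close>, and it lies in an
  associated prime of \<open>R/(c + Rx)\<close>.
\<close>
lemma assoc_prime_step:
  assumes c: "ideal c R" and P: "P \<in> assoc_primes c" and x: "x \<in> \<mm>" "regular_mod c x"
  obtains Q where "Q \<in> assoc_primes (adjoin c x)" "P \<subseteq> Q" "x \<in> Q"
proof -
  interpret c: ideal c R by fact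
  interpret P: primeideal P R using P by (rule assoc_primes_prime)
  interpret m: ideal \<mm> R by (rule m_ideal)
  have xc: "x \<in> carrier R" using x by simp
  define N where "N = {r \<in> carrier R. \<forall>p\<in>P. p \<otimes> r \<in> c}"
  obtain u where u: "u \<in> carrier R" "P = colon c u" "u \<notin> c" by (rule assoc_primes_generator[OF P])
  have uN: "u \<in> N" unfolding N_def u(2) colon_def using u(1) by blast
  \<comment> \<open>Nakayama in the form of a maximality argument: for \<open>r = a + r'x\<close> with \<open>c + Rr\<close> maximal, the ideal \<open>c + Rr'\<close> is not larger.\<close>
  define S where "S = {adjoin c r | r. r \<in> N \<and> r \<notin> c}"
  have "S \<noteq> {}" using uN u(3) unfolding S_def by blast
  moreover have "ideal d R" if "d \<in> S" for d using that adjoin_ideal[OF c] unfolding S_def N_def by blast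
  ultimately obtain M where M: "M \<in> S" "\<And>d. \<lbrakk>d \<in> S; M \<subseteq> d\<rbrakk> \<Longrightarrow> d = M"
    using ideals_maximal[of S] by (metis empty_iff)
  from M(1) obtain r where r: "r \<in> N" "r \<notin> c" "M = adjoin c r" unfolding S_def by blast
  have rc: "r \<in> carrier R" using r(1) unfolding N_def by blast
  have "\<exists>v\<in>N. v \<notin> adjoin c x"
  proof (rule ccontr)
    assume "\<not> ?thesis"
    then have "r \<in> adjoin c x" using r(1) by blast
    then obtain a r' where ar: "a \<in> c" "r' \<in> carrier R" "r = a \<oplus> r' \<otimes> x" unfolding adjoin_iff by blast
    have ac: "a \<in> carrier R" using ar by simp
    have "p \<otimes> r' \<in> c" if p: "p \<in> P" for p
    proof -
      have pc: "p \<in> carrier R" using p by simp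
      have "p \<otimes> a \<oplus> x \<otimes> (p \<otimes> r') = p \<otimes> r" unfolding ar(3) using ac ar(2) pc xc by algebra
      then have "p \<otimes> a \<oplus> x \<otimes> (p \<otimes> r') \<in> c" using r(1) p unfolding N_def by simp
      then have "x \<otimes> (p \<otimes> r') \<in> c"
        using ideal_add_iff[OF c c.I_l_closed[OF ar(1) pc]] pc xc ar(2) by simp
      then show ?thesis by (rule regular_modD[OF x(2), rotated]) (use pc ar(2) in simp)
    qed
    then have r'N: "r' \<in> N" using ar(2) unfolding N_def by blast
    have r'c: "r' \<notin> c"
    proof
      assume "r' \<in> c"
      then have "r \<in> c" unfolding ar(3) using ar(1) c.I_r_closed xc by simp
      then show False using r(2) by blast
    qed
    have i: "ideal (adjoin c r') R" using adjoin_ideal[OF c ar(2)] .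
    have "r \<in> adjoin c r'"
      unfolding adjoin_iff ar(3) m_comm[OF ar(2) xc] using ar(1) xc by blast
    then have "M \<subseteq> adjoin c r'" unfolding r(3) by (intro adjoin_subset[OF i] subset_adjoin[OF c ar(2)])
    then have "adjoin c r' = M" using M(2) r'N r'c unfolding S_def by blast
    then have "r' \<in> adjoin c r" using mem_adjoin[OF c ar(2)] r(3) by simp
    then obtain b t where bt: "b \<in> c" "t \<in> carrier R" "r' = b \<oplus> t \<otimes> r" unfolding adjoin_iff by blast
    have bc: "b \<in> carrier R" using bt by simp
    have "(\<one> \<ominus> t \<otimes> x) \<otimes> r' = r' \<ominus> t \<otimes> (r' \<otimes> x)" using bt(2) xc ar(2) by algebra
    also have "\<dots> = (b \<oplus> t \<otimes> (a \<oplus> r' \<otimes> x)) \<ominus> t \<otimes> (r' \<otimes> x)" using bt(3) ar(3) by simp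
    also have "\<dots> = b \<oplus> t \<otimes> a" using bc bt(2) ac xc ar(2) by algebra
    finally have "(\<one> \<ominus> t \<otimes> x) \<otimes> r' \<in> c" using bt(1,2) ar(1) c.I_l_closed by simp
    moreover have "t \<otimes> x \<in> \<mm>" using x(1) bt(2) m.I_l_closed by blast
    ultimately have "r' \<in> c" using one_minus_cancel[OF c] ar(2) by blast
    then show False using r'c by blast
  qed
  then obtain v where v: "v \<in> N" "v \<notin> adjoin c x" by blast
  have vc: "v \<in> carrier R" using v unfolding N_def by blast
  obtain Q where Q: "Q \<in> assoc_primes (adjoin c x)" "colon (adjoin c x) v \<subseteq> Q"
    by (rule assoc_prime_exists[OF adjoin_ideal[OF c xc] vc v(2)])
  have "P \<subseteq> colon (adjoin c x) v" using v(1) subset_adjoin[OF c xc] P.Icarr unfolding N_def colon_def by blast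
  moreover have "x \<otimes> v \<in> adjoin c x" using mult_mem_adjoin[OF c xc vc] m_comm[OF xc vc] by simp
  ultimately show thesis using that[OF Q(1)] Q(2) xc unfolding colon_def by blast
qed

text \<open>
  A regular sequence on \<open>R/c\<close> with entries in the maximal ideal. The ideal grows along the list, which suits
  induction on the list with \<open>c\<close> arbitrary.
\<close>
primrec regseq :: "'a set \<Rightarrow> 'a list \<Rightarrow> bool" where
  "regseq c [] = True"
| "regseq c (x # xs) = (x \<in> \<mm> \<and> regular_mod c x \<and> regseq (adjoin c x) xs)"

primrec adjoin_list :: "'a set \<Rightarrow> 'a list \<Rightarrow> 'a set" where
  "adjoin_list c [] = c"
| "adjoin_list c (x # xs) = adjoin_list (adjoin c x) xs"

text \<open>
  All ideals \<open>c, c + Rx\<^sub>1, c + Rx\<^sub>1 + Rx\<^sub>2, \<dots>\<close> including the last one. An element that is regular modulo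
  each of them can be moved in front of the sequence.
\<close>
primrec stages :: "'a set \<Rightarrow> 'a list \<Rightarrow> 'a set set" where
  "stages c [] = {c}"
| "stages c (x # xs) = insert c (stages (adjoin c x) xs)"

lemma m_carrier: "x \<in> \<mm> \<Longrightarrow> x \<in> carrier R" by (rule ideal.Icarr[OF m_ideal])

lemma finite_stages: "finite (stages c xs)" by (induction xs arbitrary: c) auto

lemma start_in_stages: "c \<in> stages c xs" by (cases xs) auto

lemma adjoin_list_append: "adjoin_list c (xs @ ys) = adjoin_list (adjoin_list c xs) ys"
  by (induction xs arbitrary: c) simp_all

lemma regseq_append: "regseq c (xs @ ys) \<longleftrightarrow> regseq c xs \<and> regseq (adjoin_list c xs) ys"
  by (induction xs arbitrary: c) simp_all

lemma adjoin_list_ideal: "ideal c R \<Longrightarrow> set xs \<subseteq> carrier R \<Longrightarrow> ideal (adjoin_list c xs) R"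
  by (induction xs arbitrary: c) (simp_all add: adjoin_ideal)

lemma regseq_subset_m: "regseq c xs \<Longrightarrow> set xs \<subseteq> \<mm>"
  by (induction xs arbitrary: c) auto

text \<open>
  Each entry of the sequence allows one to pass to a strictly larger associated prime: a regular element lies
  outside every associated prime of \<open>R/c\<close> and inside the prime that \<open>assoc_prime_step\<close> supplies. For \<open>c = 0\<close> this is the inequality \<open>depth R \<le> dim R/P\<close>.
\<close>
lemma regseq_prime_chain:
  assumes "ideal c R" "regseq c xs" "P \<in> assoc_primes c"
  shows "prime_chain_above R P (length xs)"
  using assms
proof (induction xs arbitrary: c P)
  case Nil
  then show ?case using prime_chain_above_0 assoc_primes_prime by fastforce
next
  case (Cons x xs)
  then have x: "x \<in> \<mm>" "regular_mod c x" "regseq (adjoin c x) xs" by simp_all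
  obtain Q where Q: "Q \<in> assoc_primes (adjoin c x)" "P \<subseteq> Q" "x \<in> Q"
    by (rule assoc_prime_step[OF Cons.prems(1,3) x(1,2)])
  have "prime_chain_above R Q (length xs)"
    using Cons.IH[OF adjoin_ideal x(3) Q(1)] Cons.prems(1) m_carrier[OF x(1)] by blast
  moreover have "P \<subset> Q" using Q regular_mod_notin_assoc[OF x(2) Cons.prems(3)] by blast
  ultimately show ?case using prime_chain_above_Suc assoc_primes_prime[OF Cons.prems(3)] by simp
qed

lemma regseq_adjoin:
  assumes "ideal c R" "regseq c ys" "z \<in> carrier R" "\<And>d. d \<in> stages c ys \<Longrightarrow> regular_mod d z"
  shows "regseq (adjoin c z) ys \<and> adjoin_list (adjoin c z) ys = adjoin (adjoin_list c ys) z"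
  using assms
proof (induction ys arbitrary: c)
  case Nil
  then show ?case by simp
next
  case (Cons y ys)
  have y: "y \<in> \<mm>" "regular_mod c y" "regseq (adjoin c y) ys" "y \<in> carrier R" using Cons.prems(2) m_carrier by auto
  have "regular_mod (adjoin c y) z" using Cons.prems(4) start_in_stages by simp
  then have "regular_mod (adjoin c z) y" using regular_mod_swap[OF Cons.prems(1) y(2)] by blast
  moreover have "regseq (adjoin (adjoin c y) z) ys \<and> adjoin_list (adjoin (adjoin c y) z) ys = adjoin (adjoin_list (adjoin c y) ys) z"
    using Cons.IH[OF adjoin_ideal[OF Cons.prems(1) y(4)] y(3) Cons.prems(3)] Cons.prems(4) by simp
  ultimately show ?case using y(1) adjoin_commute[OF Cons.prems(1) y(4) Cons.prems(3)] by simp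
qed

text \<open>
  The entry \<open>y\<close> is there so that the last stage, too, is followed by a regular element of \<open>\<mm>\<close>.
\<close>
lemma stages_regseq_snoc:
  assumes "ideal c R" "regseq c (ys @ [y])" "d \<in> stages c ys"
  shows "ideal d R \<and> \<mm> \<notin> assoc_primes d"
  using assms
proof (induction ys arbitrary: c)
  case Nil
  then show ?case using regular_mod_notin_assoc by auto
next
  case (Cons x ys)
  have x: "x \<in> \<mm>" "regular_mod c x" "regseq (adjoin c x) (ys @ [y])" using Cons.prems(2) by auto
  show ?case
  proof (cases "d = c")
    case True
    then show ?thesis using x regular_mod_notin_assoc Cons.prems(1) by blast
  next
    case False
    then show ?thesis using Cons.IH[OF adjoin_ideal x(3)] Cons.prems(1,3) m_carrier[OF x(1)] by simp
  qed
qed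

lemma prime_above_m: "primeideal P R \<Longrightarrow> \<mm> \<subseteq> P \<Longrightarrow> P = \<mm>"
  using maximalideal.I_maximal[OF maximal] primeideal.axioms(1) primeideal.I_notcarr 
    additive_subgroup.a_subset ideal.axioms(1) by metis

lemma regular_element_in_m:
  assumes "finite C" "\<And>c. c \<in> C \<Longrightarrow> ideal c R \<and> \<mm> \<notin> assoc_primes c"
  obtains z where "z \<in> \<mm>" "\<And>c. c \<in> C \<Longrightarrow> regular_mod c z"
proof -
  have "\<not> \<mm> \<subseteq> P" if "c \<in> C" "P \<in> assoc_primes c" for c P
    using assms(2) that prime_above_m[OF assoc_primes_prime[OF that(2)]] by blast
  then show thesis using regular_element_exists[OF m_ideal assms(1)] assms(2) that by metis
qed

text \<open>
  If \<open>ys\<close> were longer, then up to the length of \<open>xs\<close> each stage of \<open>ys\<close>, and each stage of \<open>xs\<close> but the last,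
  would be followed by a regular element of \<open>\<mm>\<close>. By prime avoidance a single \<open>z \<in> \<mm>\<close> is regular modulo all these
  stages. Exchanging the last entry of \<open>xs\<close> for \<open>z\<close> keeps \<open>\<mm>\<close> associated, and moving \<open>z\<close> to the front of both
  sequences gives a counterexample modulo \<open>c + Rz\<close> in which both lengths are smaller.
\<close>
lemma regseq_length_le_maximal:
  assumes "ideal c R" "regseq c xs" "\<mm> \<in> assoc_primes (adjoin_list c xs)" "regseq c ys"
  shows "length ys \<le> length xs"
  using assms
proof (induction "length xs" arbitrary: c xs ys)
  case 0
  then have "\<mm> \<in> assoc_primes c" by simp
  then show ?case using 0 regular_mod_notin_assoc by (cases ys) auto
next
  case (Suc k)
  obtain xs' x where xs: "xs = xs' @ [x]" "length xs' = k" using Suc.hyps(2) by (metis length_Suc_conv_rev)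
  show ?case
  proof (rule ccontr)
    assume "\<not> ?case"
    then have len: "length ys > Suc k" using Suc.hyps(2) by simp
    define ys' where "ys' = take (Suc k) ys"
    have ys: "ys = (ys' @ [ys ! Suc k]) @ drop (Suc (Suc k)) ys"
      unfolding ys'_def using len by (metis append_take_drop_id take_Suc_conv_app_nth)
    have rys: "regseq c (ys' @ [ys ! Suc k])" using Suc.prems(4) ys regseq_append by metis
    have rxs: "regseq c xs'" "x \<in> \<mm>" "regular_mod (adjoin_list c xs') x" 
      using Suc.prems(2) xs(1) regseq_append by simp_all
    have xs'c: "set xs' \<subseteq> carrier R" using regseq_subset_m[OF rxs(1)] m_carrier by blast
    have ei: "ideal (adjoin_list c xs') R" using adjoin_list_ideal[OF Suc.prems(1) xs'c] .
    have "ideal d R \<and> \<mm> \<notin> assoc_primes d" if "d \<in> stages c xs' \<union> stages c ys' \<union> {adjoin_list c xs'}" for d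
      using that stages_regseq_snoc[OF Suc.prems(1) rys]
        stages_regseq_snoc[OF Suc.prems(1)] Suc.prems(2) xs(1) ei regular_mod_notin_assoc[OF rxs(3)] rxs(2)
      by blast
    then obtain z where z: "z \<in> \<mm>" "\<And>d. d \<in> stages c xs' \<union> stages c ys' \<union> {adjoin_list c xs'} \<Longrightarrow> regular_mod d z"
      using regular_element_in_m[of "stages c xs' \<union> stages c ys' \<union> {adjoin_list c xs'}"] finite_stages
      by (metis (no_types, lifting) finite.emptyI finite.insertI finite_Un)
    have zc: "z \<in> carrier R" using z(1) m_carrier by blast
    have 1: "regseq (adjoin c z) xs'" "adjoin_list (adjoin c z) xs' = adjoin (adjoin_list c xs') z"
      using regseq_adjoin[OF Suc.prems(1) rxs(1) zc] z(2) by blast+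
    have 2: "regseq (adjoin c z) ys'"
      using regseq_adjoin[OF Suc.prems(1) _ zc] z(2) rys regseq_append by blast
    have "\<mm> \<in> assoc_primes (adjoin (adjoin_list c xs') x)" using Suc.prems(3) xs(1) adjoin_list_append by simp
    then have "\<mm> \<in> assoc_primes (adjoin (adjoin_list c xs') z)"
      using assoc_prime_exchange[OF ei rxs(3)] z by blast
    then have "length ys' \<le> length xs'"
      using Suc.hyps(1)[OF xs(2)[symmetric] adjoin_ideal[OF Suc.prems(1) zc] 1(1) _ 2] 1(2) by simp
    then show False using len xs(2) unfolding ys'_def by simp
  qed
qed

text \<open>
  If \<open>\<mm>\<close> is not associated to \<open>R/c\<close>, a regular element of \<open>\<mm>\<close> can be adjoined, which enlarges \<open>c\<close> strictly;
  in a Noetherian ring this stops.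
\<close>
lemma maximal_regseq_exists:
  assumes "ideal c R" "c \<subseteq> \<mm>"
  obtains xs where "regseq c xs" "\<mm> \<in> assoc_primes (adjoin_list c xs)"
proof -
  define good where "good d \<longleftrightarrow> (\<exists>xs. regseq d xs \<and> \<mm> \<in> assoc_primes (adjoin_list d xs))" for d
  have "good c"
  proof (rule ccontr)
    assume "\<not> good c"
    define S where "S = {d. ideal d R \<and> d \<subseteq> \<mm> \<and> \<not> good d}"
    have "S \<noteq> {}" using assms \<open>\<not> good c\<close> unfolding S_def by blast
    moreover have "ideal d R" if "d \<in> S" for d using that unfolding S_def by blast
    ultimately obtain M where M: "M \<in> S" "\<And>d. \<lbrakk>d \<in> S; M \<subseteq> d\<rbrakk> \<Longrightarrow> d = M"
      using ideals_maximal[of S] by (metis empty_iff)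
    then have Mi: "ideal M R" "M \<subseteq> \<mm>" "\<not> good M" unfolding S_def by blast+
    have "\<mm> \<notin> assoc_primes M"
    proof
      assume "\<mm> \<in> assoc_primes M"
      then have "good M" unfolding good_def by (intro exI[of _ "[]"]) simp
      then show False using Mi by blast
    qed
    then obtain z where z: "z \<in> \<mm>" "regular_mod M z" 
      using regular_element_in_m[of "{M}"] Mi(1) by (metis finite.emptyI finite.insertI singletonD singletonI)
    have zc: "z \<in> carrier R" using z(1) m_carrier by blast
    have "z \<notin> M"
    proof
      assume "z \<in> M"
      then have "z \<otimes> \<one> \<in> M" using zc by simp
      then have "\<one> \<in> M" by (rule regular_modD[OF z(2) one_closed])
      then show False using Mi(2) one_notin_m by blast
    qed
    then have "adjoin M z \<noteq> M" using mem_adjoin[OF Mi(1) zc] by blast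
    then have "adjoin M z \<notin> S" using M(2) subset_adjoin[OF Mi(1) zc] by blast
    moreover have "ideal (adjoin M z) R" "adjoin M z \<subseteq> \<mm>"
      using adjoin_ideal[OF Mi(1) zc] adjoin_subset[OF m_ideal Mi(2) z(1)] by blast+
    ultimately obtain xs where "regseq (adjoin M z) xs" "\<mm> \<in> assoc_primes (adjoin_list (adjoin M z) xs)"
      unfolding S_def good_def by blast
    then have "good M" unfolding good_def using z by (intro exI[of _ "z # xs"]) simp
    then show False using Mi by blast
  qed
  then show thesis using that unfolding good_def by blast
qed

end

context noetherian_cring
begin

section \<open>Disconnected punctured spectra\<close>

text \<open>
  This is what Hartshorne's connectedness theorem becomes when nothing but elements of \<open>R\<close> is used. After
  localising at \<open>Q\<close>, the punctured spectrum is the disjoint union of \<open>V(a)\<close> and \<open>V(b)\<close>, and there is a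
  function \<open>e\<close> on it that is \<open>0\<close> on \<open>V(a)\<close> and \<open>1\<close> on \<open>V(b)\<close>. Some \<open>z\<^sup>k e\<close> extends to an element
  \<open>\<alpha>\<close> of the ring. For the least such \<open>k\<close>, the element \<open>\<alpha>\<close> is not divisible by \<open>z\<close>, yet it becomes so after
  multiplication by a high power of any element of \<open>Q\<close>. So \<open>\<alpha>\<close> witnesses that \<open>Q\<close> is associated to \<open>R/z\<close>.
  
  In the proof, \<open>\<alpha>\<close> comes from a relation \<open>s z\<^sup>k = \<alpha> + \<beta>\<close> with \<open>s \<notin> Q\<close>, \<open>\<alpha> \<in> a\<close>, \<open>\<beta> \<in> b\<close> and \<open>k\<close> least.
\<close>
lemma assoc_prime_of_regular_element_if_disconnected:
  assumes a: "ideal a R" and b: "ideal b R"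
    and ab: "\<And>x y. \<lbrakk>x \<in> a; y \<in> b\<rbrakk> \<Longrightarrow> x \<otimes> y = \<zero>"
    and ann: "zero_colon R b \<subseteq> a" "zero_colon R a \<subseteq> b"
    and Q: "minimal_over (a <+> b) Q" and z: "z \<in> Q" "regular_mod {\<zero>} z"
  shows "Q \<in> assoc_primes (adjoin {\<zero>} z)"
proof -
  interpret a: ideal a R by fact
  interpret b: ideal b R by fact
  interpret Q: primeideal Q R using Q minimal_over_def by blast
  have zc: "z \<in> carrier R" using z(1) by simp
  have cancel: "r = \<zero>" if "r \<in> carrier R" "z \<otimes> r = \<zero>" for r
    using regular_modD[OF z(2) that(1)] that(2) by simp
  have sum_in_Q: "x \<oplus> y \<in> Q" if "x \<in> a" "y \<in> b" for x y
    using Q that unfolding minimal_over_def set_add_def' by blast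
  have split: "\<exists>s\<in>carrier R - Q. \<exists>k::nat. \<exists>x\<in>a. \<exists>y\<in>b. s \<otimes> q [^] k = x \<oplus> y" if "q \<in> Q" for q
    using minimal_over_nilpotent[OF add_ideals[OF a b] Q that] unfolding set_add_def' by blast
  define good where "good k \<longleftrightarrow> (\<exists>s\<in>carrier R - Q. \<exists>x\<in>a. \<exists>y\<in>b. s \<otimes> z [^] k = x \<oplus> y)" for k :: nat
  define k where "k = (LEAST k. good k)"
  have "\<exists>k. good k" using split[OF z(1)] unfolding good_def by blast
  then have "good k" unfolding k_def by (rule LeastI_ex)
  then obtain s \<alpha> \<beta> where s: "s \<in> carrier R" "s \<notin> Q" and \<alpha>: "\<alpha> \<in> a" and \<beta>: "\<beta> \<in> b" 
    and eq: "s \<otimes> z [^] k = \<alpha> \<oplus> \<beta>" unfolding good_def by blast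
  have \<alpha>c: "\<alpha> \<in> carrier R" and \<beta>c: "\<beta> \<in> carrier R" using \<alpha> \<beta> by simp_all
  have "k \<noteq> 0"
  proof
    assume "k = 0"
    then have "s = \<alpha> \<oplus> \<beta>" using eq s(1) by simp
    then show False using s(2) sum_in_Q[OF \<alpha> \<beta>] by blast
  qed
  then obtain j where k: "k = Suc j" using not0_implies_Suc by blast
  have nj: "\<not> good j" using not_less_Least[of j good] k unfolding k_def by simp
  have eq': "s \<otimes> (z \<otimes> z [^] j) = \<alpha> \<oplus> \<beta>" 
    using eq zc s(1) unfolding k by (simp add: m_comm[of "z [^] j" z])
  have zj: "z [^] j \<in> carrier R" using zc by simp
  have ad_iff: "x \<in> adjoin {\<zero>} z \<longleftrightarrow> (\<exists>r\<in>carrier R. x = z \<otimes> r)" for x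
    using zc by (auto simp: adjoin_iff m_comm)
  show ?thesis
  proof (rule assoc_prime_if_locally_nilpotent)
    show "ideal (adjoin {\<zero>} z) R" by (rule adjoin_ideal[OF zeroideal zc])
    show "primeideal Q R" ..
    show "\<alpha> \<in> carrier R" by fact
  next
    fix t assume t: "t \<in> carrier R" "t \<notin> Q"
    show "t \<otimes> \<alpha> \<notin> adjoin {\<zero>} z"
    proof
      assume "t \<otimes> \<alpha> \<in> adjoin {\<zero>} z"
      then obtain r where r: "r \<in> carrier R" "t \<otimes> \<alpha> = z \<otimes> r" unfolding ad_iff by blast
      \<comment> \<open>If \<open>t\<alpha> = zr\<close>, then \<open>z\<close> can be cancelled from \<open>ts z\<^sup>k = t\<alpha> + t\<beta>\<close> in both summands, against the minimality of \<open>k\<close>.\<close>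
      have "r \<otimes> y = \<zero>" if y: "y \<in> b" for y
      proof (rule cancel)
        have yc: "y \<in> carrier R" using y by simp
        then show "r \<otimes> y \<in> carrier R" using r by simp
        have "z \<otimes> (r \<otimes> y) = (z \<otimes> r) \<otimes> y" using zc r(1) yc by (simp add: m_assoc)
        also have "\<dots> = t \<otimes> (\<alpha> \<otimes> y)" unfolding r(2)[symmetric] using t(1) \<alpha>c yc by (simp add: m_assoc)
        also have "\<dots> = \<zero>" using ab[OF \<alpha> y] t(1) by simp
        finally show "z \<otimes> (r \<otimes> y) = \<zero>" .
      qed
      then have ra: "r \<in> a" using ann(1) r(1) unfolding zero_colon_def by blast
      define e where "e = t \<otimes> s \<otimes> z [^] j \<ominus> r"
      have ec: "e \<in> carrier R" using t s zj r unfolding e_def by simp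
      have ze: "z \<otimes> e = t \<otimes> \<beta>"
      proof -
        have "z \<otimes> e = t \<otimes> (s \<otimes> (z \<otimes> z [^] j)) \<ominus> z \<otimes> r"
          unfolding e_def using t s zj r(1) zc by algebra
        also have "\<dots> = t \<otimes> (\<alpha> \<oplus> \<beta>) \<ominus> t \<otimes> \<alpha>" unfolding eq' r(2) ..
        also have "\<dots> = t \<otimes> \<beta>" using t(1) \<alpha>c \<beta>c by algebra
        finally show ?thesis .
      qed
      have "e \<otimes> x = \<zero>" if x: "x \<in> a" for x
      proof (rule cancel)
        have xc: "x \<in> carrier R" using x by simp
        then show "e \<otimes> x \<in> carrier R" using ec by simp
        have "z \<otimes> (e \<otimes> x) = (z \<otimes> e) \<otimes> x" using zc ec xc by (simp add: m_assoc)
        also have "\<dots> = t \<otimes> (x \<otimes> \<beta>)" unfolding ze using t(1) \<beta>c xc by (simp add: m_ac)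
        also have "\<dots> = \<zero>" using ab[OF x \<beta>] t(1) by simp
        finally show "z \<otimes> (e \<otimes> x) = \<zero>" .
      qed
      then have eb: "e \<in> b" using ann(2) ec unfolding zero_colon_def by blast
      have "t \<otimes> s \<in> carrier R - Q" using t s Q.I_prime by blast
      moreover have "t \<otimes> s \<otimes> z [^] j = r \<oplus> e" unfolding e_def using t(1) s(1) zj r(1) by algebra
      ultimately have "good j" unfolding good_def using ra eb by blast
      then show False using nj by blast
    qed
  next
    fix x assume x: "x \<in> Q"
    then have xc: "x \<in> carrier R" by simp
    obtain s' l \<alpha>' \<beta>' where s': "s' \<in> carrier R - Q" and \<alpha>': "\<alpha>' \<in> a" and \<beta>': "\<beta>' \<in> b"
      and e: "s' \<otimes> x [^] (l::nat) = \<alpha>' \<oplus> \<beta>'" using split[OF x] by blast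
    have c': "\<alpha>' \<in> carrier R" "\<beta>' \<in> carrier R" "s' \<in> carrier R" "x [^] l \<in> carrier R" using \<alpha>' \<beta>' s' xc by simp_all
    have z0: "\<alpha> \<otimes> \<beta>' = \<zero>" "\<alpha>' \<otimes> \<beta> = \<zero>" using ab \<alpha> \<alpha>' \<beta> \<beta>' by blast+
    \<comment> \<open>Both \<open>s'x\<^sup>l \<alpha>\<close> and \<open>\<alpha>' s z\<^sup>k\<close> equal \<open>\<alpha>\<alpha>'\<close>, because the mixed products vanish.\<close>
    have "s' \<otimes> (x [^] l \<otimes> \<alpha>) = (s' \<otimes> x [^] l) \<otimes> \<alpha>" using c' \<alpha>c by (simp add: m_assoc)
    also have "\<dots> = \<alpha>' \<otimes> \<alpha> \<oplus> \<alpha> \<otimes> \<beta>'" unfolding e using c' \<alpha>c by algebra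
    also have "\<dots> = \<alpha>' \<otimes> \<alpha> \<oplus> \<alpha>' \<otimes> \<beta>" unfolding z0 ..
    also have "\<dots> = \<alpha>' \<otimes> (s \<otimes> (z \<otimes> z [^] j))" unfolding eq' using c' \<alpha>c \<beta>c by algebra
    also have "\<dots> = z \<otimes> (\<alpha>' \<otimes> s \<otimes> z [^] j)" using c' s(1) zc zj by (simp add: m_ac)
    finally have "s' \<otimes> (x [^] l \<otimes> \<alpha>) \<in> adjoin {\<zero>} z" unfolding ad_iff using c' s(1) zj by blast
    then show "\<exists>t\<in>carrier R - Q. \<exists>k::nat. t \<otimes> (x [^] k \<otimes> \<alpha>) \<in> adjoin {\<zero>} z" using s' by blast
  qed
qed

end

section \<open>Primes and dimension of quotient rings\<close>

lemma Sup_enat_eqI: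
  assumes "A d" "\<And>n. A n \<Longrightarrow> n \<le> d"
  shows "Sup {enat n | n. A n} = enat d"
proof (rule antisym)
  show "Sup {enat n | n. A n} \<le> enat d" using assms(2) by (intro Sup_least) auto
  show "enat d \<le> Sup {enat n | n. A n}" using assms(1) by (intro Sup_upper) auto
qed

lemma prime_chain_above_le:
  assumes "prime_chain_above R A n" "m \<le> n" shows "prime_chain_above R A m"
proof -
  obtain p where "\<And>i. i \<le> n \<Longrightarrow> primeideal (p i) R" "\<And>i. i < n \<Longrightarrow> p i \<subset> p (Suc i)" "A \<subseteq> p 0"
    using assms(1) unfolding prime_chain_above_def by blast
  then show ?thesis
    unfolding prime_chain_above_def using assms(2) by (intro exI[of _ p] conjI allI impI) simp_all
qed

lemma prime_chain_above_mono:
  assumes "prime_chain_above R A n" "B \<subseteq> A" shows "prime_chain_above R B n"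
  using assms unfolding prime_chain_above_def by (meson order_trans)

lemma krull_dim_eq: "krull_dim R = Sup {enat n | n. prime_chain_above R {} n}"
  unfolding krull_dim_def prime_chain_above_def by simp

context cring
begin

lemma quot_rep:
  assumes "y \<in> carrier (R Quot J)" obtains r where "r \<in> carrier R" "y = J +> r"
  using assms unfolding FactRing_def A_RCOSETS_def' by auto

lemma Union_image_rcos:
  assumes "ideal J R" "ideal K R" "J \<subseteq> K" shows "\<Union>((+>) J ` K) = K"
  using ideal_incl_iff[OF assms(1,2)] assms(3) by simp

lemma image_Union_rcos:
  assumes J: "ideal J R" and P: "ideal P (R Quot J)"
  shows "(+>) J ` \<Union>P = P" "ideal (\<Union>P) R" "J \<subseteq> \<Union>P"
proof -
  have "P \<in> (\<lambda>K. (+>) J ` K) ` {K. ideal K R \<and> J \<subseteq> K}"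
    using quot_ideal_correspondence[OF J] P unfolding bij_betw_def by blast
  then obtain K where K: "ideal K R" "J \<subseteq> K" "P = (+>) J ` K" by blast
  have "\<Union>P = K" unfolding K(3) by (rule Union_image_rcos[OF J K(1,2)])
  then show "(+>) J ` \<Union>P = P" "ideal (\<Union>P) R" "J \<subseteq> \<Union>P" using K by simp_all
qed

lemma rcos_mem_iff:
  assumes J: "ideal J R" and P: "ideal P (R Quot J)" and a: "a \<in> carrier R"
  shows "J +> a \<in> P \<longleftrightarrow> a \<in> \<Union>P"
  using canonical_proj_vimage_mem_iff[OF J additive_subgroup.a_subset[OF ideal.axioms(1)[OF P]] a] by simp

lemma rcos_mult: 
  assumes "ideal J R" "a \<in> carrier R" "b \<in> carrier R"
  shows "(J +> a) \<otimes>\<^bsub>R Quot J\<^esub> (J +> b) = J +> (a \<otimes> b)"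
  using ideal.rcoset_mult_add[OF assms] by (simp add: FactRing_def)

lemma rcos_closed: "ideal J R \<Longrightarrow> a \<in> carrier R \<Longrightarrow> J +> a \<in> carrier (R Quot J)"
  using a_rcosetsI[OF additive_subgroup.a_subset[OF ideal.axioms(1)]] by (simp add: FactRing_def)

text \<open>
  Ideals of \<open>R/J\<close> are sets of cosets, so the preimage in \<open>R\<close> of such an ideal is its union.
\<close>
lemma primeideal_Union:
  assumes J: "ideal J R" and P: "primeideal P (R Quot J)"
  shows "primeideal (\<Union>P) R"
proof (rule primeidealI)
  interpret P: primeideal P "R Quot J" by fact
  have Pi: "ideal P (R Quot J)" ..
  show "ideal (\<Union>P) R" by (rule image_Union_rcos(2)[OF J Pi])
  show "carrier R \<noteq> \<Union>P"
  proof
    assume eq: "carrier R = \<Union>P"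
    have "carrier (R Quot J) \<subseteq> P"
    proof
      fix y assume "y \<in> carrier (R Quot J)"
      then obtain r where "r \<in> carrier R" "y = J +> r" by (rule quot_rep)
      then show "y \<in> P" using rcos_mem_iff[OF J Pi] eq by simp
    qed
    then show False using P.I_notcarr P.a_subset by blast
  qed
  fix a b assume ab: "a \<in> carrier R" "b \<in> carrier R" "a \<otimes> b \<in> \<Union>P"
  then have "(J +> a) \<otimes>\<^bsub>R Quot J\<^esub> (J +> b) \<in> P"
    using rcos_mem_iff[OF J Pi, of "a \<otimes> b"] rcos_mult[OF J] by simp
  then have "J +> a \<in> P \<or> J +> b \<in> P" using P.I_prime rcos_closed[OF J] ab(1,2) by blast
  then show "a \<in> \<Union>P \<or> b \<in> \<Union>P" using rcos_mem_iff[OF J Pi] ab(1,2) by blast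
qed (rule is_cring)

lemma primeideal_image:
  assumes J: "ideal J R" and P: "primeideal P R" "J \<subseteq> P"
  shows "primeideal ((+>) J ` P) (R Quot J)"
proof (rule primeidealI)
  interpret P: primeideal P R by fact
  have Pi: "ideal P R" ..
  let ?P = "(+>) J ` P"
  show i: "ideal ?P (R Quot J)" by (rule ring_ideal_imp_quot_ideal[OF J Pi])
  have mem: "J +> a \<in> ?P \<longleftrightarrow> a \<in> P" if "a \<in> carrier R" for a
    using rcos_mem_iff[OF J i that] Union_image_rcos[OF J Pi P(2)] by simp
  show "cring (R Quot J)" by (rule ideal.quotient_is_cring[OF J is_cring])
  have "J +> \<one> \<notin> ?P" using mem primeideal_one[OF P(1)] by simp
  then show "carrier (R Quot J) \<noteq> ?P" using rcos_closed[OF J one_closed] by blast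
  fix x y assume xy: "x \<in> carrier (R Quot J)" "y \<in> carrier (R Quot J)" "x \<otimes>\<^bsub>R Quot J\<^esub> y \<in> ?P"
  obtain a where a: "a \<in> carrier R" "x = J +> a" by (rule quot_rep[OF xy(1)])
  obtain b where b: "b \<in> carrier R" "y = J +> b" by (rule quot_rep[OF xy(2)])
  have "a \<otimes> b \<in> P" using xy(3) mem a b rcos_mult[OF J] by simp
  then show "x \<in> ?P \<or> y \<in> ?P" using P.I_prime mem a b by blast
qed

lemma prime_chain_above_quot:
  assumes J: "ideal J R" and P: "ideal P (R Quot J)"
  shows "prime_chain_above (R Quot J) P n \<longleftrightarrow> prime_chain_above R (\<Union>P) n"
proof
  assume "prime_chain_above (R Quot J) P n"
  then obtain p where p: "\<And>i. i \<le> n \<Longrightarrow> primeideal (p i) (R Quot J)" "\<And>i. i < n \<Longrightarrow> p i \<subset> p (Suc i)" "P \<subseteq> p 0"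
    unfolding prime_chain_above_def by blast
  have "\<Union>(p i) \<subset> \<Union>(p (Suc i))" if "i < n" for i
  proof -
    have i: "ideal (p i) (R Quot J)" "ideal (p (Suc i)) (R Quot J)" 
      using that by (auto intro!: primeideal.axioms(1) p(1))
    have "\<Union>(p i) \<noteq> \<Union>(p (Suc i))"
    proof
      assume "\<Union>(p i) = \<Union>(p (Suc i))"
      then have "(+>) J ` \<Union>(p i) = (+>) J ` \<Union>(p (Suc i))" by (rule arg_cong)
      then have "p i = p (Suc i)" unfolding image_Union_rcos(1)[OF J i(1)] image_Union_rcos(1)[OF J i(2)] .
      then show False using p(2)[OF that] by blast
    qed
    then show ?thesis using p(2)[OF that] by blast
  qed
  moreover have "\<Union>P \<subseteq> \<Union>(p 0)" using p(3) by blast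
  ultimately show "prime_chain_above R (\<Union>P) n"
    unfolding prime_chain_above_def using primeideal_Union[OF J] p(1)
    by (intro exI[of _ "\<lambda>i. \<Union>(p i)"] conjI allI impI) simp_all
next
  assume "prime_chain_above R (\<Union>P) n"
  then obtain p where p: "\<And>i. i \<le> n \<Longrightarrow> primeideal (p i) R" "\<And>i. i < n \<Longrightarrow> p i \<subset> p (Suc i)" "\<Union>P \<subseteq> p 0"
    unfolding prime_chain_above_def by blast
  have JP: "J \<subseteq> p i" if "i \<le> n" for i
    using that
  proof (induction i)
    case 0 then show ?case using p(3) image_Union_rcos(3)[OF J P] by blast
  next
    case (Suc i) 
    then have "J \<subseteq> p i" "p i \<subset> p (Suc i)" using p(2)[of i] by simp_all
    then show ?case by blast
  qed
  have "(+>) J ` p i \<subset> (+>) J ` p (Suc i)" if "i < n" for i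
  proof -
    have i: "ideal (p i) R" "ideal (p (Suc i)) R" using that by (auto intro!: primeideal.axioms(1) p(1))
    have "(+>) J ` p i \<noteq> (+>) J ` p (Suc i)"
    proof
      assume "(+>) J ` p i = (+>) J ` p (Suc i)"
      then have "\<Union>((+>) J ` p i) = \<Union>((+>) J ` p (Suc i))" by (rule arg_cong)
      then have "p i = p (Suc i)"
        unfolding Union_image_rcos[OF J i(1) JP[OF less_imp_le[OF that]]] Union_image_rcos[OF J i(2) JP[OF Suc_leI[OF that]]] .
      then show False using p(2)[OF that] by blast
    qed
    then show ?thesis using p(2)[OF that] by blast
  qed
  moreover have "P \<subseteq> (+>) J ` p 0" using image_Union_rcos(1)[OF J P] p(3) by blast
  ultimately show "prime_chain_above (R Quot J) P n"
    unfolding prime_chain_above_def using primeideal_image[OF J p(1) JP] 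
    by (intro exI[of _ "\<lambda>i. (+>) J ` p i"] conjI allI impI) simp_all
qed

lemma krull_dim_quot:
  assumes J: "ideal J R"
  shows "krull_dim (R Quot J) = Sup {enat n | n. prime_chain_above R J n}"
proof -
  interpret Q: cring "R Quot J" by (rule ideal.quotient_is_cring[OF J is_cring])
  have "prime_chain_above (R Quot J) {} n \<longleftrightarrow> prime_chain_above (R Quot J) {\<zero>\<^bsub>R Quot J\<^esub>} n" for n
  proof -
    have "\<zero>\<^bsub>R Quot J\<^esub> \<in> P" if "primeideal P (R Quot J)" for P
      using that additive_subgroup.zero_closed ideal.axioms(1) primeideal.axioms(1) by blast
    then show ?thesis unfolding prime_chain_above_def by blast
  qed
  moreover have "\<Union>{\<zero>\<^bsub>R Quot J\<^esub>} = J" by (simp add: FactRing_def)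
  ultimately have "prime_chain_above (R Quot J) {} n \<longleftrightarrow> prime_chain_above R J n" for n
    using prime_chain_above_quot[OF J Q.zeroideal] by simp
  then show ?thesis unfolding krull_dim_eq by simp
qed

text \<open>
  For a prime \<open>P\<close> of \<open>R/J\<close> the dimension of \<open>(R/J)/P\<close> is thus read off from chains in \<open>R\<close>, without identifying
  this iterated quotient with a quotient of \<open>R\<close>.
\<close>
lemma krull_dim_quot_quot:
  assumes J: "ideal J R" and P: "ideal P (R Quot J)"
  shows "krull_dim (R Quot J Quot P) = Sup {enat n | n. prime_chain_above R (\<Union>P) n}"
proof -
  interpret Q: cring "R Quot J" by (rule ideal.quotient_is_cring[OF J is_cring])
  show ?thesis using Q.krull_dim_quot[OF P] prime_chain_above_quot[OF J P] by simp
qed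

end

context noetherian_cring
begin

lemma minimal_prime_quot:
  assumes J: "ideal J R" and P: "minimal_prime (R Quot J) P"
  shows "minimal_over J (\<Union>P)"
proof -
  have Pp: "primeideal P (R Quot J)" using P unfolding minimal_prime_def by blast
  then have Pi: "ideal P (R Quot J)" by (rule primeideal.axioms(1))
  have "K = \<Union>P" if K: "primeideal K R" "J \<subseteq> K" "K \<subseteq> \<Union>P" for K
  proof -
    have "(+>) J ` K \<subseteq> P" using K(3) image_Union_rcos(1)[OF J Pi] by blast
    then have "(+>) J ` K = P" using P primeideal_image[OF J K(1,2)] unfolding minimal_prime_def by blast
    then show ?thesis using Union_image_rcos[OF J primeideal.axioms(1)[OF K(1)] K(2)] by blast
  qed
  then show ?thesis unfolding minimal_over_def 
    using primeideal_Union[OF J Pp] image_Union_rcos(3)[OF J Pi] by blast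
qed

lemma noetherian_quot:
  assumes J: "ideal J R" shows "noetherian_ring (R Quot J)"
proof -
  interpret Q: cring "R Quot J" by (rule ideal.quotient_is_cring[OF J is_cring])
  show ?thesis
  proof (rule Q.noetherian_ringI)
    fix P assume P: "ideal P (R Quot J)"
    obtain A where A: "A \<subseteq> carrier R" "finite A" "\<Union>P = Idl A"
      using finetely_gen[OF image_Union_rcos(2)[OF J P]] by blast
    let ?A = "(+>) J ` A"
    have Ac: "?A \<subseteq> carrier (R Quot J)" using A(1) rcos_closed[OF J] by blast
    define G where "G = Idl\<^bsub>R Quot J\<^esub> ?A"
    have G: "ideal G (R Quot J)" unfolding G_def by (rule Q.genideal_ideal[OF Ac])
    have AP: "A \<subseteq> \<Union>P" unfolding A(3) by (rule genideal_self[OF A(1)])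
    then have "?A \<subseteq> P" using image_Union_rcos(1)[OF J P] by blast
    then have "G \<subseteq> P" unfolding G_def by (rule Q.genideal_minimal[OF P])
    moreover have "P \<subseteq> G"
    proof -
      have "?A \<subseteq> G" unfolding G_def by (rule Q.genideal_self[OF Ac])
      then have "A \<subseteq> \<Union>G" using rcos_mem_iff[OF J G] A(1) by blast
      then have "\<Union>P \<subseteq> \<Union>G" unfolding A(3) by (rule genideal_minimal[OF image_Union_rcos(2)[OF J G]])
      then have "(+>) J ` \<Union>P \<subseteq> (+>) J ` \<Union>G" by (rule image_mono)
      then show ?thesis unfolding image_Union_rcos(1)[OF J G] image_Union_rcos(1)[OF J P] .
    qed
    ultimately show "\<exists>A\<subseteq>carrier (R Quot J). finite A \<and> P = Idl\<^bsub>R Quot J\<^esub> A"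
      using Ac A(2) unfolding G_def by blast
  qed
qed

end

context noetherian_local_ring
begin

lemma quotient_local:
  assumes J: "ideal J R" "J \<subseteq> \<mm>"
  shows "noetherian_local_ring (R Quot J) ((+>) J ` \<mm>)"
proof -
  interpret Q: cring "R Quot J" by (rule ideal.quotient_is_cring[OF J(1) is_cring])
  interpret QN: noetherian_ring "R Quot J" by (rule noetherian_quot[OF J(1)])
  let ?m = "(+>) J ` \<mm>"
  have mp: "primeideal ?m (R Quot J)" by (rule primeideal_image[OF J(1) m_prime J(2)])
  have Um: "\<Union>?m = \<mm>" by (rule Union_image_rcos[OF J(1) m_ideal J(2)])
  have below: "K \<subseteq> ?m" if K: "ideal K (R Quot J)" "K \<noteq> carrier (R Quot J)" for K
  proof -
    have "\<one> \<notin> \<Union>K"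
    proof
      assume "\<one> \<in> \<Union>K"
      then have "J +> \<one> \<in> K" using rcos_mem_iff[OF J(1) K(1)] by blast
      then have "\<one>\<^bsub>R Quot J\<^esub> \<in> K" by (simp add: FactRing_def)
      then show False using ideal.one_imp_carrier[OF K(1)] K(2) by blast
    qed
    then have "\<Union>K \<subseteq> \<mm>" by (rule proper_ideal_subset_m[OF image_Union_rcos(2)[OF J(1) K(1)]])
    then have "(+>) J ` \<Union>K \<subseteq> ?m" by (rule image_mono)
    then show ?thesis unfolding image_Union_rcos(1)[OF J(1) K(1)] .
  qed
  have m_not: "?m \<noteq> carrier (R Quot J)" using primeideal.I_notcarr[OF mp] by blast
  show ?thesis
  proof (intro noetherian_local_ring.intro noetherian_local_ring_axioms.intro)
    show "cring (R Quot J)" "noetherian_ring (R Quot J)" by (fact Q.is_cring, fact QN.noetherian_ring_axioms)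
    show "maximalideal ?m (R Quot J)"
    proof (rule maximalidealI)
      show "ideal ?m (R Quot J)" by (rule primeideal.axioms(1)[OF mp])
      show "carrier (R Quot J) \<noteq> ?m" using m_not by blast
      show "K = ?m \<or> K = carrier (R Quot J)" if "ideal K (R Quot J)" "?m \<subseteq> K" for K
        using below[OF that(1)] that(2) by blast
    qed
    show "K = ?m" if K: "maximalideal K (R Quot J)" for K
    proof -
      have Ki: "ideal K (R Quot J)" "K \<noteq> carrier (R Quot J)"
        using K maximalideal.axioms(1) maximalideal.I_notcarr by blast+
      show ?thesis
        using maximalideal.I_maximal[OF K primeideal.axioms(1)[OF mp] below[OF Ki]] m_not
          additive_subgroup.a_subset[OF ideal.axioms(1)[OF primeideal.axioms(1)[OF mp]]] by blast
    qed
  qed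
qed

section \<open>Depth\<close>

lemma genideal_insert:
  assumes "S \<subseteq> carrier R" "x \<in> carrier R"
  shows "Idl (insert x S) = adjoin (Idl S) x"
proof
  have S: "ideal (Idl S) R" "S \<subseteq> Idl S" using genideal_ideal genideal_self assms by blast+
  show "Idl (insert x S) \<subseteq> adjoin (Idl S) x"
    using genideal_minimal[OF adjoin_ideal[OF S(1) assms(2)]] mem_adjoin[OF S(1) assms(2)]
      subset_adjoin[OF S(1) assms(2)] S(2) by blast
  have c: "insert x S \<subseteq> carrier R" using assms by blast
  show "adjoin (Idl S) x \<subseteq> Idl (insert x S)"
    using adjoin_subset[OF genideal_ideal[OF c] subset_Idl_subset[OF c]] genideal_self[OF c] by blast
qed

lemma adjoin_list_zero_eq: "set xs \<subseteq> carrier R \<Longrightarrow> adjoin_list {\<zero>} xs = Idl (set xs)"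
proof (induction xs rule: rev_induct)
  case Nil
  have "Idl {} = {\<zero>}" 
    using genideal_minimal[OF zeroideal, of "{}"] 
      additive_subgroup.zero_closed[OF ideal.axioms(1)[OF genideal_ideal[of "{}"]]] by blast
  then show ?case by simp
next
  case (snoc x xs)
  then show ?case using genideal_insert[of "set xs" x] by (simp add: adjoin_list_append)
qed

lemma regular_mod_if_nonzerodivisor:
  assumes J: "ideal J R" and x: "x \<in> carrier R" and nz: "nonzerodivisor (R Quot J) (J +> x)"
  shows "regular_mod J x"
proof -
  have "a \<in> J" if a: "a \<in> carrier R" "x \<otimes> a \<in> J" for a
  proof -
    have "(J +> x) \<otimes>\<^bsub>R Quot J\<^esub> (J +> a) = J +> (x \<otimes> a)" by (rule rcos_mult[OF J x a(1)])
    also have "\<dots> = \<zero>\<^bsub>R Quot J\<^esub>" 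
      using ideal.rcos_const_imp_mem[OF J] a(2) a_coset_join2[OF _ additive_subgroup.a_subgroup[OF ideal.axioms(1)[OF J]]] x a(1)
      by (simp add: FactRing_def)
    finally have "J +> a = \<zero>\<^bsub>R Quot J\<^esub>" using nz rcos_closed[OF J a(1)] unfolding nonzerodivisor_def by blast
    then show ?thesis using ideal.rcos_const_imp_mem[OF J a(1)] by (simp add: FactRing_def)
  qed
  then show ?thesis unfolding regular_mod_def using x by blast
qed

lemma regseq_if_regular_sequence:
  assumes "regular_sequence R xs" "set xs \<subseteq> \<mm>"
  shows "regseq {\<zero>} xs"
proof -
  have "\<And>i. i < length xs \<Longrightarrow> nonzerodivisor (R Quot (Idl (set (take i xs)))) (Idl (set (take i xs)) +> xs ! i)"
    using assms(1) unfolding regular_sequence_def by (simp add: Let_def)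
  then show ?thesis using assms(2)
  proof (induction xs rule: rev_induct)
    case Nil
    then show ?case by simp
  next
    case (snoc x xs)
    have sub: "set xs \<subseteq> \<mm>" "x \<in> \<mm>" using snoc.prems(2) by simp_all
    have "regseq {\<zero>} xs"
    proof (rule snoc.IH[OF _ sub(1)])
      fix i assume i: "i < length xs"
      show "nonzerodivisor (R Quot (Idl (set (take i xs)))) (Idl (set (take i xs)) +> xs ! i)"
        using snoc.prems(1)[of i] i by (simp add: nth_append)
    qed
    moreover have "regular_mod (adjoin_list {\<zero>} xs) x"
    proof -
      have c: "set xs \<subseteq> carrier R" using sub(1) m_carrier by blast
      have "nonzerodivisor (R Quot (Idl (set xs))) (Idl (set xs) +> x)" using snoc.prems(1)[of "length xs"] by simp
      then show ?thesis unfolding adjoin_list_zero_eq[OF c]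
        by (rule regular_mod_if_nonzerodivisor[OF genideal_ideal[OF c] m_carrier[OF sub(2)]])
    qed
    ultimately show ?case using sub(2) by (simp add: regseq_append)
  qed
qed

text \<open>
  The depth is a supremum of lengths; it is finite because a maximal regular sequence bounds them all.
\<close>
lemma depth_attained:
  obtains ys where "regseq {\<zero>} ys" "depth R \<mm> = enat (length ys)"
proof -
  define S where "S = {length xs | xs. regular_sequence R xs \<and> set xs \<subseteq> \<mm>}"
  have dep: "depth R \<mm> = Sup {enat n | n. n \<in> S}" unfolding depth_def S_def by (rule arg_cong[of _ _ Sup]) blast
  have "{\<zero>} \<subseteq> \<mm>" using additive_subgroup.zero_closed[OF ideal.axioms(1)[OF m_ideal]] by blast
  then obtain xs where xs: "regseq {\<zero>} xs" "\<mm> \<in> assoc_primes (adjoin_list {\<zero>} xs)"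
    by (rule maximal_regseq_exists[OF zeroideal])
  have bound: "n \<le> length xs" if "n \<in> S" for n
    using that regseq_length_le_maximal[OF zeroideal xs] regseq_if_regular_sequence unfolding S_def by blast
  show thesis
  proof (cases "S = {}")
    case True
    then have "depth R \<mm> = 0" unfolding dep by (simp add: Sup_enat_def)
    \<comment> \<open>The supremum of the empty set of lengths is \<open>0\<close>, the length of the empty sequence.\<close>
    then show thesis using that[of "[]"] by (simp add: zero_enat_def)
  next
    case False
    have fin: "finite S" using bound by (meson finite_nat_set_iff_bounded_le)
    then have M: "Max S \<in> S" "\<And>n. n \<in> S \<Longrightarrow> n \<le> Max S" using False by simp_all
    then have "depth R \<mm> = enat (Max S)" unfolding dep by (intro Sup_enat_eqI)
    moreover obtain ys where "regseq {\<zero>} ys" "length ys = Max S"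
    proof -
      obtain ys where "length ys = Max S" "regular_sequence R ys" "set ys \<subseteq> \<mm>"
        using M(1) unfolding S_def by auto
      then show ?thesis using that regseq_if_regular_sequence by blast
    qed
    ultimately show thesis using that by metis
  qed
qed

end

section \<open>Associated primes of modules, annihilators of powers\<close>

context cring
begin

lemma ass_self_module: "ass R (self_module R) = assoc_primes {\<zero>}"
  unfolding ass_def assoc_primes_def colon_def self_module_def by simp

lemma ass_quot_module:
  assumes I: "ideal I R"
  shows "ass R (quot_module R I) = assoc_primes I"
proof -
  interpret I: ideal I R by fact
  have ann: "{r \<in> carrier R. (I +> r) \<otimes>\<^bsub>R Quot I\<^esub> (I +> w) = \<zero>\<^bsub>R Quot I\<^esub>} = colon I w"
    if w: "w \<in> carrier R" for w
  proof -
    have "(I +> r) \<otimes>\<^bsub>R Quot I\<^esub> (I +> w) = \<zero>\<^bsub>R Quot I\<^esub> \<longleftrightarrow> r \<otimes> w \<in> I" if r: "r \<in> carrier R" for r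
      unfolding rcos_mult[OF I r w] using I.rcos_const_imp_mem[of "r \<otimes> w"] a_coset_join2[OF _ I.a_subgroup, of "r \<otimes> w"] r w
      by (auto simp: FactRing_def)
    then show ?thesis unfolding colon_def by blast
  qed
  have "(\<exists>y\<in>carrier (R Quot I). P = {r \<in> carrier R. (I +> r) \<otimes>\<^bsub>R Quot I\<^esub> y = \<zero>\<^bsub>R Quot I\<^esub>}) \<longleftrightarrow>
        (\<exists>w\<in>carrier R. P = colon I w)" for P
  proof
    assume "\<exists>y\<in>carrier (R Quot I). P = {r \<in> carrier R. (I +> r) \<otimes>\<^bsub>R Quot I\<^esub> y = \<zero>\<^bsub>R Quot I\<^esub>}"
    then obtain y where y: "y \<in> carrier (R Quot I)" "P = {r \<in> carrier R. (I +> r) \<otimes>\<^bsub>R Quot I\<^esub> y = \<zero>\<^bsub>R Quot I\<^esub>}"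
      by blast
    obtain w where w: "w \<in> carrier R" "y = I +> w" by (rule quot_rep[OF y(1)])
    show "\<exists>w\<in>carrier R. P = colon I w" using y(2) w(1) unfolding w(2) ann[OF w(1)] by blast
  next
    assume "\<exists>w\<in>carrier R. P = colon I w"
    then obtain w where w: "w \<in> carrier R" "P = colon I w" by blast
    show "\<exists>y\<in>carrier (R Quot I). P = {r \<in> carrier R. (I +> r) \<otimes>\<^bsub>R Quot I\<^esub> y = \<zero>\<^bsub>R Quot I\<^esub>}"
      unfolding w(2) ann[OF w(1), symmetric] using rcos_closed[OF I w(1)] by blast
  qed
  then show ?thesis unfolding ass_def assoc_primes_def quot_module_def by simp
qed

lemma zero_colon_ideal:
  assumes B: "B \<subseteq> carrier R" shows "ideal (zero_colon R B) R"
proof (rule idealI[OF ring_axioms])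
  have Bc: "x \<in> carrier R" if "x \<in> B" for x using B that by blast
  show "subgroup (zero_colon R B) (add_monoid R)"
  proof (rule add.subgroupI)
    show "zero_colon R B \<subseteq> carrier R" unfolding zero_colon_def by blast
    have "\<zero> \<in> zero_colon R B" unfolding zero_colon_def using Bc by simp
    then show "zero_colon R B \<noteq> {}" by blast
    show "\<ominus> a \<in> zero_colon R B" if "a \<in> zero_colon R B" for a
      using that Bc unfolding zero_colon_def by (simp add: l_minus)
    show "a \<oplus> b \<in> zero_colon R B" if "a \<in> zero_colon R B" "b \<in> zero_colon R B" for a b
      using that Bc unfolding zero_colon_def by (simp add: l_distr)
  qed
  fix a r assume a: "a \<in> zero_colon R B" and r: "r \<in> carrier R"
  then show "r \<otimes> a \<in> zero_colon R B" using Bc unfolding zero_colon_def by (simp add: m_assoc)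
  then show "a \<otimes> r \<in> zero_colon R B" using a r m_comm unfolding zero_colon_def by simp
qed

lemma zero_colon_antimono: "B \<subseteq> C \<Longrightarrow> zero_colon R C \<subseteq> zero_colon R B"
  unfolding zero_colon_def by blast

lemma subset_zero_colon_zero_colon: 
  assumes "B \<subseteq> carrier R" shows "B \<subseteq> zero_colon R (zero_colon R B)"
proof
  fix x assume x: "x \<in> B"
  then have xc: "x \<in> carrier R" using assms by blast
  have "x \<otimes> r = \<zero>" if "r \<in> zero_colon R B" for r
    using that x xc m_comm unfolding zero_colon_def by simp
  then show "x \<in> zero_colon R (zero_colon R B)" using xc unfolding zero_colon_def[of R "zero_colon R B"] by blast
qed

lemma ideal_pow_Suc: "ideal_pow R I (Suc n) = ideal_prod R (ideal_pow R I n) I"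
  by (simp add: nat_pow_def ideals_set_def)

lemma ideal_pow_0: "ideal_pow R I 0 = carrier R"
  by (simp add: nat_pow_def ideals_set_def)

lemma ideal_pow_ideal: assumes I: "ideal I R" shows "ideal (ideal_pow R I n) R"
proof (induction n)
  case 0
  show ?case unfolding ideal_pow_0 by (rule oneideal)
next
  case (Suc n)
  then show ?case unfolding ideal_pow_Suc by (rule ideal_prod_is_ideal[OF _ I])
qed

lemma ideal_pow_Suc_subset: 
  assumes "ideal I R" shows "ideal_pow R I (Suc n) \<subseteq> ideal_pow R I n"
  unfolding ideal_pow_Suc using ideal_prod_inter[OF ideal_pow_ideal[OF assms] assms] by blast

lemma nat_pow_mem_ideal_pow:
  assumes "ideal I R" "x \<in> I" shows "x [^] n \<in> ideal_pow R I n"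
proof (induction n)
  case 0
  show ?case unfolding ideal_pow_0 by simp
next
  case (Suc n)
  then show ?case unfolding ideal_pow_Suc using assms(2) by (simp add: ideal_prod.prod)
qed

end

context noetherian_cring
begin

lemma zero_colon_powers_stabilise:
  assumes I: "ideal I R"
  obtains N where "N \<ge> 1" "(\<Union>n\<in>{1..}. zero_colon R (ideal_pow R I n)) = zero_colon R (ideal_pow R I N)"
proof -
  define Z where "Z n = zero_colon R (ideal_pow R I n)" for n
  have step: "Z n \<subseteq> Z (Suc n)" for n
    unfolding Z_def by (rule zero_colon_antimono[OF ideal_pow_Suc_subset[OF I]])
  have mono: "Z m \<subseteq> Z n" if "m \<le> n" for m n
    by (rule lift_Suc_mono_le[of Z, OF step that])
  have "ideal (Z n) R" for n unfolding Z_def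
    by (rule zero_colon_ideal[OF additive_subgroup.a_subset[OF ideal.axioms(1)[OF ideal_pow_ideal[OF I]]]])
  then have "ideal d R" if "d \<in> Z ` {1..}" for d using that by blast
  moreover have "Z ` {1..} \<noteq> {}" by blast
  ultimately obtain M where M: "M \<in> Z ` {1..}" "\<And>d. \<lbrakk>d \<in> Z ` {1..}; M \<subseteq> d\<rbrakk> \<Longrightarrow> d = M"
    using ideals_maximal[of "Z ` {1..}"] by (metis empty_iff)
  from M(1) obtain N where N: "N \<ge> 1" "M = Z N" by auto
  have "Z n \<subseteq> Z N" for n
  proof -
    have "Z (max n N) = Z N" using M(2)[of "Z (max n N)"] mono[of N "max n N"] N by simp
    then show ?thesis using mono[of n "max n N"] by simp
  qed
  then have "(\<Union>n\<in>{1..}. Z n) = Z N" using N(1) by blast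
  then show thesis using that[OF N(1)] unfolding Z_def by blast
qed

end

section \<open>Cohen-Macaulay local rings\<close>

context cohen_macaulay_local_ring
begin

lemma krull_dim_finite:
  obtains ys where "regseq {\<zero>} ys" "krull_dim R = enat (length ys)"
proof -
  obtain ys where "regseq {\<zero>} ys" "depth R \<mm> = enat (length ys)" by (rule depth_attained)
  then show thesis using that[of ys] depth_eq_dim by simp
qed

lemma prime_chain_length_le:
  assumes "krull_dim R = enat d" "prime_chain_above R A n" shows "n \<le> d"
proof -
  have "prime_chain_above R {} n" using prime_chain_above_mono[OF assms(2)] by blast
  then have "enat n \<le> krull_dim R" unfolding krull_dim_eq by (intro Sup_upper) blast
  then show ?thesis using assms(1) by simp
qed

text \<open>
  Unmixedness. A regular sequence of length \<open>dim R\<close> gives a chain of that length above \<open>P\<close>; a prime properly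
  contained in \<open>P\<close> would make it too long.
\<close>
lemma assoc_prime_minimal:
  assumes P: "P \<in> assoc_primes {\<zero>}" shows "minimal_over {\<zero>} P"
proof -
  obtain ys where ys: "regseq {\<zero>} ys" "krull_dim R = enat (length ys)" by (rule krull_dim_finite)
  have chain: "prime_chain_above R P (length ys)" by (rule regseq_prime_chain[OF zeroideal ys(1) P])
  have "P' = P" if P': "primeideal P' R" "P' \<subseteq> P" for P'
  proof (rule ccontr)
    assume "P' \<noteq> P"
    then have "prime_chain_above R P' (Suc (length ys))" using prime_chain_above_Suc[OF chain] P' by blast
    then show False using prime_chain_length_le[OF ys(2)] by fastforce
  qed
  then show ?thesis unfolding minimal_over_def
    using assoc_primes_prime[OF P] assoc_primes_superset[OF zeroideal P] by blast
qed

text \<open>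
  Among the primes between \<open>c\<close> and \<open>p\<close>, one above which there is a longest chain of primes is minimal over \<open>c\<close>.
  Such a prime exists because \<open>dim R\<close> is finite.
\<close>
lemma minimal_over_exists:
  assumes p: "primeideal p R" "c \<subseteq> p"
  obtains Q where "minimal_over c Q" "Q \<subseteq> p"
proof -
  obtain ys where "regseq {\<zero>} ys" and ys: "krull_dim R = enat (length ys)" by (rule krull_dim_finite)
  define good where "good n \<longleftrightarrow> (\<exists>q. primeideal q R \<and> c \<subseteq> q \<and> q \<subseteq> p \<and> prime_chain_above R q n)" for n
  have "good 0" unfolding good_def using p prime_chain_above_0[OF p(1), of p] by blast
  have bound: "\<And>n. good n \<Longrightarrow> n \<le> length ys" unfolding good_def using prime_chain_length_le[OF ys] by blast
  define n where "n = (GREATEST n. good n)"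
  have "good n" unfolding n_def by (rule GreatestI_nat[of good 0, OF \<open>good 0\<close> bound])
  then obtain q where q: "primeideal q R" "c \<subseteq> q" "q \<subseteq> p" "prime_chain_above R q n" unfolding good_def by blast
  have "q' = q" if q': "primeideal q' R" "c \<subseteq> q'" "q' \<subseteq> q" for q'
  proof (rule ccontr)
    assume "q' \<noteq> q"
    then have "prime_chain_above R q' (Suc n)" using prime_chain_above_Suc[OF q(4)] q' by blast
    then have "good (Suc n)" unfolding good_def using q' q(3) by blast
    then have "Suc n \<le> n" unfolding n_def by (rule Greatest_le_nat[of good _ "length ys", OF _ bound])
    then show False by simp
  qed
  then have "minimal_over c q" unfolding minimal_over_def using q by blast
  then show thesis using that q(3) by blast
qed

text \<open>
  Chains of primes above \<open>B = I + J\<close> have length at most \<open>d - 1\<close>, because a minimal prime of \<open>R\<close> can be put in front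
  of them; and above each minimal prime \<open>Q\<close> of \<open>B\<close> there is a chain of length \<open>d - 1\<close>, because \<open>Q\<close> is associated to
  \<open>R/z\<close> for a regular element \<open>z\<close>. Every dimension in the conclusion is determined by these two bounds.
\<close>
theorem equidimensional_quotient:
  assumes I: "ideal I R"
    and proper: "I \<noteq> carrier R"
    and nonnil: "\<not> nilpotent_ideal R I"
    and ass: "mass R (quot_module R I) \<subseteq> ass R (self_module R)"
  defines "A \<equiv> R Quot (I <+> (\<Union>n\<in>{1..}. zero_colon R (ideal_pow R I n)))"
  shows "(\<exists>\<nn>. noetherian_local_ring A \<nn>) \<and> equidimensional A \<and> krull_dim A + 1 = krull_dim R"
proof -
  interpret I: ideal I R by fact
  obtain N where N: "N \<ge> 1" "(\<Union>n\<in>{1..}. zero_colon R (ideal_pow R I n)) = zero_colon R (ideal_pow R I N)"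
    by (rule zero_colon_powers_stabilise[OF I])
  define K where "K = ideal_pow R I N"
  define J where "J = zero_colon R K"
  have K: "ideal K R" "K \<subseteq> carrier R" unfolding K_def 
    using ideal_pow_ideal[OF I] additive_subgroup.a_subset ideal.axioms(1) by blast+
  have J: "ideal J R" "J \<subseteq> carrier R" unfolding J_def using zero_colon_ideal[OF K(2)] 
    by (simp_all add: zero_colon_def)
  interpret J: ideal J R by fact
  have A: "A = R Quot (I <+> J)" unfolding A_def J_def K_def N(2) ..
  \<comment> \<open>\<open>(J : I) = J\<close>: if \<open>wI \<subseteq> J\<close>, then \<open>w\<close> annihilates \<open>I\<^sup>N I\<close>.\<close>
  have colon_J: "w \<in> J" if w: "w \<in> carrier R" "\<And>i. i \<in> I \<Longrightarrow> i \<otimes> w \<in> J" for w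
  proof -
    have "w \<otimes> y = \<zero>" if "y \<in> ideal_pow R I (Suc N)" for y
      using that unfolding ideal_pow_Suc
    proof (induction y rule: ideal_prod.induct)
      case (prod p i)
      have pc: "p \<in> carrier R" "i \<in> carrier R" "p \<in> K" using prod K unfolding K_def by auto
      have "w \<otimes> (p \<otimes> i) = (i \<otimes> w) \<otimes> p" using w(1) pc by (simp add: m_ac)
      then show ?case using w(2)[OF prod(2)] pc(3) unfolding J_def zero_colon_def by simp
    next
      case (sum s1 s2)
      have "s1 \<in> carrier R" "s2 \<in> carrier R" 
        using sum.hyps(1,2) ideal_prod_in_carrier[OF ideal_pow_ideal[OF I] I] by blast+
      then show ?case using sum.IH w(1) by (simp add: r_distr)
    qed
    then have "w \<in> zero_colon R (ideal_pow R I (Suc N))" using w(1) unfolding zero_colon_def by blast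
    moreover have "Suc N \<in> {1..}" by simp
    ultimately show ?thesis using N(2) unfolding J_def K_def by blast
  qed
  have one_J: "\<one> \<notin> J"
  proof
    assume "\<one> \<in> J"
    then have "y = \<zero>" if "y \<in> K" for y using that K(2) unfolding J_def zero_colon_def by force
    then have "K = {\<zero>}" using additive_subgroup.zero_closed[OF ideal.axioms(1)[OF K(1)]] by blast
    then show False using nonnil N(1) unfolding nilpotent_ideal_def K_def by blast
  qed
  have "\<one> \<notin> I" using proper I.one_imp_carrier by blast
  then have IJm: "I \<subseteq> \<mm>" "J \<subseteq> \<mm>" using proper_ideal_subset_m I J(1) one_J by blast+
  define B where "B = I <+>\<^bsub>R\<^esub> J"
  have B: "ideal B R" unfolding B_def by (rule add_ideals[OF I J(1)])
  have B_subset: "B \<subseteq> d \<longleftrightarrow> I \<subseteq> d \<and> J \<subseteq> d" if d: "ideal d R" for d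
    unfolding B_def union_genideal[OF I J(1), symmetric]
    using Idl_subset_ideal[OF d, of "I \<union> J"] J(2) I.a_subset by simp
  have Bm: "B \<subseteq> \<mm>" using B_subset[OF m_ideal] IJm by blast
  \<comment> \<open>A minimal prime of \<open>R\<close> containing \<open>J\<close> has the form \<open>(J : w)\<close> with \<open>w \<notin> J\<close>; if it contained \<open>I\<close>, then \<open>w \<in> (J : I) = J\<close>.\<close>
  have not_both: False if P: "minimal_over {\<zero>} P" "I \<subseteq> P" "J \<subseteq> P" for P
  proof -
    have zJ: "{\<zero>} \<subseteq> J" using additive_subgroup.zero_closed[OF J.is_additive_subgroup] by blast
    have "minimal_over J P" using P(1,3) zJ unfolding minimal_over_def by blast
    then have "P \<in> assoc_primes J" by (rule minimal_over_assoc[OF J(1)])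
    then obtain w where w: "w \<in> carrier R" "P = colon J w" "w \<notin> J" by (rule assoc_primes_generator)
    then have "w \<in> J" using colon_J[OF w(1)] P(2) unfolding w(2) colon_def by blast
    then show False using w(3) by blast
  qed
  obtain ys where ys: "regseq {\<zero>} ys" "krull_dim R = enat (length ys)" by (rule krull_dim_finite)
  define d where "d = length ys"
  have dim: "krull_dim R = enat d" unfolding d_def by (rule ys(2))
  define a where "a = zero_colon R J"
  have a: "ideal a R" "a \<subseteq> carrier R" unfolding a_def using zero_colon_ideal[OF J(2)] 
    by (simp_all add: zero_colon_def)
  have Ka: "K \<subseteq> a" unfolding a_def J_def by (rule subset_zero_colon_zero_colon[OF K(2)])
  have annJ: "zero_colon R a \<subseteq> J" unfolding J_def by (rule zero_colon_antimono[OF Ka])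
  \<comment> \<open>\<open>P0\<close> is a component of \<open>V(I)\<close> through \<open>Q\<close>. It does not contain \<open>J\<close>, so it contains the annihilator \<open>a\<close> of \<open>J\<close>.\<close>
  have component: "\<exists>P0. minimal_over {\<zero>} P0 \<and> P0 \<subset> Q \<and> a \<subseteq> P0" if Q: "primeideal Q R" "I \<subseteq> Q" "J \<subseteq> Q" for Q
  proof -
    obtain P0 where P0: "minimal_over I P0" "P0 \<subseteq> Q" by (rule minimal_over_exists[OF Q(1,2)])
    have P0p: "primeideal P0 R" "I \<subseteq> P0" using P0(1) unfolding minimal_over_def by blast+
    have "P0 \<in> assoc_primes I" by (rule minimal_over_assoc[OF I P0(1)])
    moreover have "P' = P0" if "P' \<in> assoc_primes I" "P' \<subseteq> P0" for P'
      using that P0(1) assoc_primes_prime assoc_primes_superset[OF I] unfolding minimal_over_def by blast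
    ultimately have "P0 \<in> mass R (quot_module R I)" unfolding mass_def ass_quot_module[OF I] by blast
    then have "P0 \<in> assoc_primes {\<zero>}" using ass ass_self_module by blast
    then have min: "minimal_over {\<zero>} P0" by (rule assoc_prime_minimal)
    then have "\<not> J \<subseteq> P0" using not_both P0p(2) by blast
    then obtain j where j: "j \<in> J" "j \<notin> P0" by blast
    have "a \<subseteq> P0"
    proof
      fix x assume x: "x \<in> a"
      have "x \<otimes> j = \<zero>" using x j(1) unfolding a_def zero_colon_def by blast
      then have "x \<otimes> j \<in> P0" 
        using additive_subgroup.zero_closed[OF ideal.axioms(1)[OF primeideal.axioms(1)[OF P0p(1)]]] by simp
      then show "x \<in> P0" using primeideal.I_prime[OF P0p(1)] x a(2) j J(2) by blast
    qed
    then show ?thesis using min P0(2) Q(3) \<open>\<not> J \<subseteq> P0\<close> by blast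
  qed
  have upper: "Suc n \<le> d" if "prime_chain_above R B n" for n
  proof -
    obtain p where p: "\<And>i. i \<le> n \<Longrightarrow> primeideal (p i) R" "\<And>i. i < n \<Longrightarrow> p i \<subset> p (Suc i)" "B \<subseteq> p 0"
      using \<open>prime_chain_above R B n\<close> unfolding prime_chain_above_def by blast
    have p0: "primeideal (p 0) R" using p(1) by simp
    have "I \<subseteq> p 0" "J \<subseteq> p 0" using p(3) B_subset[OF primeideal.axioms(1)[OF p0]] by blast+
    then obtain P0 where P0: "minimal_over {\<zero>} P0" "P0 \<subset> p 0" using component[OF p0] by blast
    have "prime_chain_above R (p 0) n" unfolding prime_chain_above_def using p(1,2)
      by (intro exI[of _ p] conjI allI impI) simp_all
    then have "prime_chain_above R P0 (Suc n)" using prime_chain_above_Suc P0 unfolding minimal_over_def by blast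
    then show ?thesis by (rule prime_chain_length_le[OF dim])
  qed
  have lower: "prime_chain_above R Q (d - 1)" if Q: "minimal_over B Q" for Q
  proof -
    have Qp: "primeideal Q R" "B \<subseteq> Q" using Q unfolding minimal_over_def by blast+
    have Qi: "ideal Q R" using Qp(1) by (rule primeideal.axioms(1))
    have IJ: "I \<subseteq> Q" "J \<subseteq> Q" using Qp(2) B_subset[OF Qi] by blast+
    obtain P0 where P0: "minimal_over {\<zero>} P0" "P0 \<subset> Q" "a \<subseteq> P0" using component[OF Qp(1) IJ] by blast
    have "a <+> J \<subseteq> Q" unfolding union_genideal[OF a(1) J(1), symmetric]
      using genideal_minimal[OF Qi, of "a \<union> J"] P0 IJ(2) by blast
    moreover have "P = Q" if P: "primeideal P R" "a <+>\<^bsub>R\<^esub> J \<subseteq> P" "P \<subseteq> Q" for P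
    proof -
      have Pi: "ideal P R" using P(1) by (rule primeideal.axioms(1))
      have aJ: "a \<subseteq> P" "J \<subseteq> P" 
        using P(2) genideal_self[of "a \<union> J"] a(2) J(2) unfolding union_genideal[OF a(1) J(1), symmetric] by blast+
      have "I \<subseteq> P"
      proof
        fix i assume i: "i \<in> I"
        then have "i [^] N \<in> P" using nat_pow_mem_ideal_pow[OF I i] Ka aJ(1) unfolding K_def by blast
        then show "i \<in> P" by (rule primeideal_nat_pow[OF P(1) I.Icarr[OF i]])
      qed
      then have "B \<subseteq> P" using B_subset[OF Pi] aJ(2) by blast
      then show ?thesis using Q P(1,3) unfolding minimal_over_def by blast
    qed
    ultimately have Qmin: "minimal_over (a <+> J) Q" using Qp(1) unfolding minimal_over_def by blast
    \<comment> \<open>So \<open>Q\<close> contains a regular element, by prime avoidance.\<close>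
    have nsub: "\<not> Q \<subseteq> P" if P: "P \<in> assoc_primes {\<zero>}" for P
    proof
      assume "Q \<subseteq> P"
      then have "Q = P" using assoc_prime_minimal[OF P] Qp(1) 
          additive_subgroup.zero_closed[OF ideal.axioms(1)[OF Qi]] unfolding minimal_over_def by blast
      then show False using not_both[OF assoc_prime_minimal[OF P]] IJ by blast
    qed
    obtain z where z: "z \<in> Q" "\<And>c. c \<in> {{\<zero>}} \<Longrightarrow> regular_mod c z"
      by (rule regular_element_exists[OF Qi, of "{{\<zero>}}"]) (use nsub zeroideal in blast)+
    have zreg: "regular_mod {\<zero>} z" using z(2) by blast
    have zc: "z \<in> carrier R" using zreg unfolding regular_mod_def by blast
    have Qass: "Q \<in> assoc_primes (adjoin {\<zero>} z)"
    proof (rule assoc_prime_of_regular_element_if_disconnected[OF a(1) J(1) _ _ annJ Qmin z(1) zreg])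
      show "x \<otimes> y = \<zero>" if "x \<in> a" "y \<in> J" for x y using that unfolding a_def zero_colon_def by blast
      show "zero_colon R J \<subseteq> a" unfolding a_def ..
    qed
    have zm: "z \<in> \<mm>" 
      using z(1) proper_ideal_subset_m[OF Qi primeideal_one[OF Qp(1)]] by blast
    have ai: "ideal (adjoin {\<zero>} z) R" by (rule adjoin_ideal[OF zeroideal zc])
    have "{\<zero>} \<subseteq> \<mm>" using additive_subgroup.zero_closed[OF ideal.axioms(1)[OF m_ideal]] by blast
    then have "adjoin {\<zero>} z \<subseteq> \<mm>" by (rule adjoin_subset[OF m_ideal _ zm])
    then obtain xs where xs: "regseq (adjoin {\<zero>} z) xs" "\<mm> \<in> assoc_primes (adjoin_list (adjoin {\<zero>} z) xs)"
      by (rule maximal_regseq_exists[OF ai])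
    \<comment> \<open>Both \<open>ys\<close> and \<open>z # xs\<close> are regular sequences on \<open>R\<close>, and the second one cannot be continued.\<close>
    have "length ys \<le> length (z # xs)"
      by (rule regseq_length_le_maximal[OF zeroideal _ _ ys(1)]) (use xs zm zreg in simp_all)
    moreover have "prime_chain_above R Q (length xs)" by (rule regseq_prime_chain[OF ai xs(1) Qass])
    moreover have "d - 1 \<le> length xs" using calculation(1) unfolding d_def by simp
    ultimately show ?thesis using prime_chain_above_le by blast
  qed
  have dim_eq: "Sup {enat n | n. prime_chain_above R C n} = enat (d - 1)"
    if C: "B \<subseteq> C" and low: "prime_chain_above R C (d - 1)" for C
  proof (rule Sup_enat_eqI[where A = "prime_chain_above R C", OF low])
    fix n assume "prime_chain_above R C n"
    then have "Suc n \<le> d" by (rule upper[OF prime_chain_above_mono[OF _ C]])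
    then show "n \<le> d - 1" by simp
  qed
  obtain Q0 where Q0: "minimal_over B Q0" by (rule minimal_over_exists[OF m_prime Bm])
  have Q0B: "prime_chain_above R B (d - 1)" 
    using prime_chain_above_mono[OF lower[OF Q0]] Q0 unfolding minimal_over_def by blast
  have dimA: "krull_dim A = enat (d - 1)"
    unfolding A B_def[symmetric] krull_dim_quot[OF B] by (rule dim_eq[OF subset_refl Q0B])
  have local: "noetherian_local_ring A ((+>) B ` \<mm>)"
    unfolding A B_def[symmetric] by (rule quotient_local[OF B Bm])
  have "krull_dim (A Quot P) = enat (d - 1)" if P: "minimal_prime A P" for P
  proof -
    have P': "minimal_prime (R Quot B) P" using P unfolding A B_def .
    have Pi: "ideal P (R Quot B)" using P' primeideal.axioms(1) unfolding minimal_prime_def by blast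
    have min: "minimal_over B (\<Union>P)" by (rule minimal_prime_quot[OF B P'])
    then have "B \<subseteq> \<Union>P" unfolding minimal_over_def by blast
    then show ?thesis unfolding A B_def[symmetric] krull_dim_quot_quot[OF B Pi]
      by (rule dim_eq) (rule lower[OF min])
  qed
  moreover have "cring A" "noetherian_ring A"
    by (fact noetherian_local_ring.axioms(1)[OF local], fact noetherian_local_ring.axioms(2)[OF local])
  ultimately have "equidimensional A" unfolding equidimensional_def using dimA by blast
  moreover have "d \<ge> 1" using upper[OF Q0B] by simp
  then have "krull_dim A + 1 = krull_dim R" unfolding dimA dim by (simp add: one_enat_def)
  ultimately show ?thesis using local by blast
qed

end

theorem theorem1p3:
  fixes R :: "('a, 'b) ring_scheme" and \<mm> I :: "'a set"
  assumes "cohen_macaulay_local_ring R \<mm>"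
    and "ideal I R"
    and "I \<noteq> carrier R"
    and "\<not> nilpotent_ideal R I"
    and "mass R (quot_module R I) \<subseteq> ass R (self_module R)"
  defines "A \<equiv> R Quot (I <+>\<^bsub>R\<^esub> (\<Union>n\<in>{1..}. zero_colon R (ideal_pow R I n)))"
  shows "(\<exists>\<nn>. noetherian_local_ring A \<nn>) \<and> equidimensional A \<and> krull_dim A + 1 = krull_dim R"
  unfolding A_def by (rule cohen_macaulay_local_ring.equidimensional_quotient[OF assms(1-5)])

end
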